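(* Let $f\colon\mathbb{T}^2\to\mathbb{T}^2$ be a homeomorphism homotopic to a nontrivial Dehn twist, and let $\widetilde f\colon\mathbb{R}^2\to\mathbb{R}^2$ be a lift of $f$. Assume that there exist $\varrho\in\mathbb{R}\setminus\mathbb{Q}$ and $C>0$ such that $$\left|\mathrm{pr}_2\bigl(\widetilde f^{\,n}(\tilde z)-\tilde z\bigr)-n\varrho\right|\le C\qquad\text{for every }\tilde z\in\mathbb{R}^2\text{ and every }n\in\mathbb{Z}.$$ Then $f$ admits an irrational circle factor with rotation number $\varrho$; that is, there exists a continuous surjection $h\colon\mathbb{T}^2\to\mathbb{T}$ such that $h\circ f=R_\varrho\circ h$.
   Context: $\mathbb{T}=\mathbb{R}/\mathbb{Z}$ and $\mathbb{T}^2=\mathbb{R}^2/\mathbb{Z}^2$. The map $\mathrm{pr}_2\colon\mathbb{R}^2\to\mathbb{R}$ is the projection onto the second coordinate. For $k\in\mathbb{Z}$ let $I_k=\begin{pmatrix}1&k\\0&1\end{pmatrix}$; the automorphism of $\mathbb{T}^2$ induced by $I_k$ is called a Dehn twist, and it is nontrivial if $k\neq0$. Thus "$f$ is homotopic to a nontrivial Dehn twist" means that $f$ is homotopic to the toral automorphism induced by $I_k$ for some $k\in\mathbb{Z}\setminus\{0\}$. A lift of $f$ is a homeomorphism $\widetilde f\colon\mathbb{R}^2\to\mathbb{R}^2$ covering $f$ under the quotient map $\mathbb{R}^2\to\mathbb{T}^2$. $R_\varrho\colon\mathbb{T}\to\mathbb{T}$ is the rotation $R_\varrho(x)=x+\varrho$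 (mod $1$). *)

theory Defs
  imports "HOL-Analysis.Analysis"
begin

lemma Ints_diff_commute: "(x::real) - y \<in> \<int> \<longleftrightarrow> y - x \<in> \<int>"
  using Ints_minus[of "x - y"] Ints_minus[of "y - x"] by auto

lemma Ints_diff_trans: "(x::real) - y \<in> \<int> \<Longrightarrow> y - z \<in> \<int> \<Longrightarrow> x - z \<in> \<int>"
  using Ints_add[of "x - y" "y - z"] by simp

quotient_type circle = real / "\<lambda>x y :: real. x - y \<in> \<int>"
proof (rule equivpI)
  show "reflp (\<lambda>x y :: real. x - y \<in> \<int>)"
    by (simp add: reflp_def)
  show "symp (\<lambda>x y :: real. x - y \<in> \<int>)"
    by (simp add: symp_def Ints_diff_commute)
  show "transp (\<lambda>x y :: real. x - y \<in> \<int>)"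
    by (rule transpI) (rule Ints_diff_trans)
qed

quotient_type torus = "real^2" / "\<lambda>z w :: real^2. \<forall>i. (z - w) $ i \<in> \<int>"
proof (rule equivpI)
  show "reflp (\<lambda>z w :: real^2. \<forall>i. (z - w) $ i \<in> \<int>)"
    by (simp add: reflp_def)
  show "symp (\<lambda>z w :: real^2. \<forall>i. (z - w) $ i \<in> \<int>)"
    by (simp add: symp_def Ints_diff_commute)
  show "transp (\<lambda>z w :: real^2. \<forall>i. (z - w) $ i \<in> \<int>)"
    by (rule transpI) (auto intro: Ints_diff_trans)
qed

text \<open>The quotient maps are the generated abstraction functions
  \<^const>\<open>abs_circle\<close> and \<^const>\<open>abs_torus\<close>; both types carry the quotient topology.\<close>

instantiation circle :: topological_space
begin

definition open_circle :: "circle set \<Rightarrow> bool" where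
  "open_circle U \<longleftrightarrow> open (abs_circle -` U)"

instance
  by standard (auto simp: open_circle_def vimage_Union)

end

instantiation torus :: topological_space
begin

definition open_torus :: "torus set \<Rightarrow> bool" where
  "open_torus U \<longleftrightarrow> open (abs_torus -` U)"

instance
  by standard (auto simp: open_torus_def vimage_Union)

end

lift_definition rotation :: "real \<Rightarrow> circle \<Rightarrow> circle" is "\<lambda>\<rho> x. x + \<rho>"
  by simp

definition dehn_matrix :: "int \<Rightarrow> real^2^2" where
  "dehn_matrix k = vector [vector [1, of_int k], vector [0, 1]]"

lemma dehn_matrix_diff_Ints:
  assumes "\<forall>i. (z - w) $ i \<in> \<int>"
  shows "\<forall>i. (dehn_matrix k *v z - dehn_matrix k *v w) $ i \<in> \<int>"
proof -
  have 1: "z $ 1 - w $ 1 \<in> \<int>" and 2: "z $ 2 - w $ 2 \<in> \<int>"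
    using assms by simp_all
  have "z $ 1 - w $ 1 + of_int k * (z $ 2 - w $ 2) \<in> \<int>"
    using 1 2 by (intro Ints_add Ints_mult Ints_of_int)
  with 2 show ?thesis
    by (simp add: forall_2 dehn_matrix_def matrix_vector_mult_def sum_2 algebra_simps)
qed

lift_definition dehn_twist :: "int \<Rightarrow> torus \<Rightarrow> torus" is "\<lambda>k z. dehn_matrix k *v z"
  using dehn_matrix_diff_Ints by blast

definition homeo :: "('a::topological_space \<Rightarrow> 'b::topological_space) \<Rightarrow> bool" where
  "homeo f \<longleftrightarrow> (\<exists>g. homeomorphism UNIV UNIV f g)"

definition is_lift :: "(real^2 \<Rightarrow> real^2) \<Rightarrow> (torus \<Rightarrow> torus) \<Rightarrow> bool" where
  "is_lift F f \<longleftrightarrow> homeo F \<and> abs_torus \<circ> F = f \<circ> abs_torus"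

text \<open>Meaningful for bijective \<open>f\<close>, where \<^const>\<open>inv\<close> is the genuine inverse.\<close>

definition int_iterate :: "('a \<Rightarrow> 'a) \<Rightarrow> int \<Rightarrow> 'a \<Rightarrow> 'a" where
  "int_iterate f n = (if 0 \<le> n then f ^^ nat n else inv f ^^ nat (- n))"

definition admits_irrational_circle_factor :: "(torus \<Rightarrow> torus) \<Rightarrow> real \<Rightarrow> bool" where
  "admits_irrational_circle_factor f \<rho> \<longleftrightarrow> \<rho> \<notin> \<rat> \<and>
     (\<exists>h :: torus \<Rightarrow> circle. continuous_on UNIV h \<and> surj h \<and> h \<circ> f = rotation \<rho> \<circ> h)"

end

theory Submission
  imports Defs "HOL-Complex_Analysis.Winding_Numbers"
begin

text \<open>
  Identify the plane with the complex numbers and let \<open>\<phi> n\<close> be the iterates of the lift. The open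
  sets \<open>upper r\<close>, the union over \<open>n\<close> of the preimages under \<open>\<phi> n\<close> of the half-planes above height
  \<open>r + n * \<rho>\<close>, are connected and satisfy \<open>\<phi> n ` upper r = upper (r + n * \<rho>)\<close>. Let \<open>lower r\<close> be the component
  below \<open>upper r\<close> of the complement of its closure. The candidate for the semiconjugacy is
  \<open>height z = Inf {r. z \<in> lower r}\<close>, and it is continuous unless for some \<open>a < b\<close> there is a pinch, a point
  in the closure of both \<open>lower a\<close> and \<open>upper b\<close>.

  Suppose there is one. By density of the orbits of the rotation there are pinches \<open>z\<^sub>0, \<dots>, z\<^sub>N = z\<^sub>0 + \<i>\<close>
  such that consecutive ones lie in the closures of a common pair \<open>lower a\<close>, \<open>upper b\<close> with \<open>a < b\<close>.
  Pinches of such a pair are ordered along the strip between the two sets, every iterate preserves this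
  order, and a vertical path in \<open>lower b \<union> upper a\<close> (which misses all the pinches) shows that the
  order agrees with the order of real parts up to a bounded error. Hence \<open>\<phi> n\<close>, for \<open>n * \<rho>\<close> close
  to an integer, spreads the \<open>z\<^sub>i\<close> horizontally by a bounded amount, which contradicts
  \<open>\<phi> n (z\<^sub>0 + \<i>) = \<phi> n z\<^sub>0 + n * k + \<i>\<close> with \<open>k \<noteq> 0\<close>.
\<close>

subsection \<open>Vertical barriers and pinches in the plane\<close>

text \<open>Being connected, unbounded and off the curve, \<open>S\<close> puts \<open>g\<close>
  into an unbounded complementary component, hence outside.\<close>

lemma winding_number_eq_0_avoiding_unbounded:
  assumes "path c" "pathfinish c = pathstart c" "connected S" "\<not> bounded S" "g \<in> S"
    and "S \<inter> path_image c = {}"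
  shows "winding_number c g = 0"
proof -
  have "S \<subseteq> connected_component_set (- path_image c) g"
    using assms by (intro connected_component_maximal) auto
  then have "g \<in> outside (path_image c)"
    using assms(4) bounded_subset by (auto simp: outside)
  then show ?thesis
    using assms winding_number_zero_in_outside by blast
qed

text \<open>A line from below to above through the gate \<open>g\<close>, cut at \<open>g\<close> into its lower part \<open>L\<close> and its upper part \<open>U\<close>.\<close>

definition barrier :: "real \<Rightarrow> real \<Rightarrow> complex \<Rightarrow> complex set \<Rightarrow> complex set \<Rightarrow> bool" where
  "barrier X Y g L U \<longleftrightarrow> closed L \<and> closed U \<and> connected L \<and> connected U \<and>
     \<not> bounded L \<and> \<not> bounded U \<and> g \<in> L \<and> g \<in> U \<and>
     L \<subseteq> {z. \<bar>Re z\<bar> < X \<and> Im z < Y} \<and> U \<subseteq> {z. \<bar>Re z\<bar> < X \<and> - Y < Im z}"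

text \<open>\<open>A\<close> passes above \<open>g\<close> and \<open>B\<close> below it: as \<open>L\<close> and \<open>U\<close> are connected and unbounded, the two
  paths can be replaced by the upper and the lower way around a rectangle containing \<open>g\<close>.\<close>

lemma winding_number_around_barrier:
  assumes bar: "barrier X Y g L U"
    and A: "path A" "path_image A \<inter> L = {}" and B: "path B" "path_image B \<inter> U = {}"
    and ends: "pathstart A = pathstart B" "pathfinish A = pathfinish B"
    and left: "connected_component (- (L \<union> U)) (pathstart A) (Complex (- X) (- Y))"
    and right: "connected_component (- (L \<union> U)) (pathfinish A) (Complex X (- Y))"
  shows "winding_number (A +++ reversepath B) g = - 1"
proof -
  have cl: "closed L" "closed U" and conn: "connected L" "connected U"
    and unb: "\<not> bounded L" "\<not> bounded U" and gL: "g \<in> L" and gU: "g \<in> U"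
    and Lsub: "L \<subseteq> {z. \<bar>Re z\<bar> < X \<and> Im z < Y}" and Usub: "U \<subseteq> {z. \<bar>Re z\<bar> < X \<and> - Y < Im z}"
    using bar by (auto simp: barrier_def)
  have g: "\<bar>Re g\<bar> < X" "Im g < Y" "- Y < Im g" using gL gU Lsub Usub by auto
  have op: "open (- (L \<union> U))" using cl by (intro open_Compl closed_Un)
  obtain P where P: "path P" "path_image P \<inter> (L \<union> U) = {}" "pathstart P = pathstart A"
      "pathfinish P = Complex (- X) (- Y)"
    using left op by (auto simp flip: path_component_eq_connected_component_set open_path_connected_component simp: path_component_def)
  obtain Q where Q: "path Q" "path_image Q \<inter> (L \<union> U) = {}" "pathstart Q = Complex X (- Y)"
      "pathfinish Q = pathfinish A"
    using right[THEN connected_component_sym] op by (auto simp flip: open_path_connected_component simp: path_component_def)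
  define a1 a2 a3 a4 where a: "a1 = Complex (- X) (- Y)" "a2 = Complex X (- Y)"
    "a3 = Complex X Y" "a4 = Complex (- X) Y"
  let ?W = "\<lambda>c. winding_number c g"
  have seg: "path_image (linepath a1 a2) \<inter> U = {}" "path_image (linepath a2 a3) \<inter> L = {}"
     "path_image (linepath a3 a4) \<inter> L = {}" "path_image (linepath a4 a1) \<inter> L = {}"
    using g Lsub Usub unfolding a
    by (auto simp: closed_segment_same_Re closed_segment_same_Im)
  have segg: "g \<notin> path_image (linepath a1 a2)" "g \<notin> path_image (linepath a2 a3)"
     "g \<notin> path_image (linepath a3 a4)" "g \<notin> path_image (linepath a4 a1)"
    using seg gL gU by auto
  \<comment> \<open>\<open>T\<close> climbs the left side of the rectangle, follows the top and
    descends the right side. Like \<open>A\<close> it misses \<open>L\<close>, whereas the bottom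
    side misses \<open>U\<close>, as \<open>B\<close> does.\<close>
  define T where "T = reversepath (linepath a4 a1) +++ reversepath (linepath a3 a4) +++ reversepath (linepath a2 a3)"
  have T: "path T" "pathstart T = a1" "pathfinish T = a2" "path_image T \<inter> L = {}"
    using seg by (auto simp: T_def path_image_join closed_segment_commute)
  have WT: "?W T = - (?W (linepath a2 a3) + ?W (linepath a3 a4) + ?W (linepath a4 a1))"
    using segg unfolding T_def
    by (simp add: winding_number_join path_image_join winding_number_reversepath del: reversepath_linepath path_image_linepath)
  have "?W (rectpath a1 a3) = 1"
    using g by (intro winding_number_rectpath) (auto simp: in_box_complex_iff a)
  moreover have "rectpath a1 a3 = linepath a1 a2 +++ linepath a2 a3 +++ linepath a3 a4 +++ linepath a4 a1"
    by (simp add: rectpath_def a Let_def)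
  ultimately have rect: "?W (linepath a1 a2) - ?W T = 1"
    using segg unfolding WT
    by (simp add: winding_number_join path_image_join algebra_simps del: path_image_linepath)
  note im = path_image_join path_image_reversepath
  have gn: "g \<notin> path_image A" "g \<notin> path_image B" "g \<notin> path_image P" "g \<notin> path_image Q" "g \<notin> path_image T"
    using A B P Q T gL gU by auto
  \<comment> \<open>\<open>A\<close> closed up over the top misses \<open>L\<close>, and below
    \<open>B\<close> closed up along the bottom misses \<open>U\<close>, so both loops have winding
    number 0. The contributions of \<open>P\<close> and \<open>Q\<close> cancel in the
    difference.\<close>
  have "?W (A +++ reversepath (P +++ T +++ Q)) = 0"
    using A P Q T a ends gL conn unb
    by (intro winding_number_eq_0_avoiding_unbounded[of _ L]) (auto simp: im)
  then have 1: "?W A = ?W P + ?W T + ?W Q"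
    using A P Q T a ends gn
    by (simp add: winding_number_join winding_number_reversepath im algebra_simps)
  have "?W (B +++ reversepath (P +++ linepath a1 a2 +++ Q)) = 0"
    using B P Q seg a ends gU conn unb
    by (intro winding_number_eq_0_avoiding_unbounded[of _ U]) (auto simp: im)
  then have 2: "?W B = ?W P + ?W (linepath a1 a2) + ?W Q"
    using B P Q a ends gn segg
    by (simp add: winding_number_join winding_number_reversepath im algebra_simps del: path_image_linepath)
  have "?W (A +++ reversepath B) = ?W A - ?W B"
    using A B ends gn by (simp add: winding_number_join winding_number_reversepath im)
  then show ?thesis using 1 2 rect by algebra
qed

section \<open>Jordan curves through two pinches\<close>

text \<open>The segment realizes the distance between the parts of \<open>S\<close> and
  \<open>T\<close> in the closed ball. Convexity keeps it in the ball, and a further point of either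
  set on it would give a smaller distance.\<close>

lemma ball_crossing_segment:
  fixes S T :: "'a::euclidean_space set"
  assumes "compact S" "compact T" "S \<inter> ball q r \<noteq> {}" "T \<inter> ball q r \<noteq> {}"
  obtains x y where "x \<in> S" "y \<in> T" "closed_segment x y \<subseteq> cball q r"
    "closed_segment x y \<inter> S = {x}" "closed_segment x y \<inter> T = {y}"
proof -
  let ?S = "S \<inter> cball q r" and ?T = "T \<inter> cball q r"
  have ne: "?S \<noteq> {}" "?T \<noteq> {}" using assms by auto
  have c: "compact ?S" "compact ?T" using assms by auto
  obtain x y where xy: "x \<in> ?S" "y \<in> ?T" and "dist x y = setdist ?S ?T"
    using setdist_compact_closed[OF c(1) compact_imp_closed[OF c(2)] ne] by auto
  then have mn: "dist x y \<le> dist x' y'" if "x' \<in> ?S" "y' \<in> ?T" for x' y'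
    using setdist_le_dist[OF that] by simp
  have sub: "closed_segment x y \<subseteq> cball q r"
    using xy by (intro closed_segment_subset) auto
  have segment: "z = x \<or> dist z y < dist x y" "z = y \<or> dist x z < dist x y" if z: "z \<in> closed_segment x y" for z
  proof -
    have "dist x y = dist x z + dist z y"
      using z between_mem_segment[of x y z] between[of x y z] by auto
    then show "z = x \<or> dist z y < dist x y" "z = y \<or> dist x z < dist x y"
      by (smt (verit) dist_pos_lt dist_commute)+
  qed
  show thesis
  proof
    show "closed_segment x y \<inter> S = {x}"
      using xy sub segment(1) mn[of _ y] by (auto simp: subset_iff) (meson linorder_not_less)
    show "closed_segment x y \<inter> T = {y}"
      using xy sub segment(2) mn[of x] by (auto simp: subset_iff) (meson linorder_not_less)
  qed (use xy sub in auto)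
qed

text \<open>Two arcs, one in \<open>U\<close> and one in \<open>V\<close>, run from near
  \<open>q\<close> to near \<open>q'\<close> and are cut down to the parts between two crossing
  segments, one in each ball. The segments touch the arcs only at their own ends and the balls are
  disjoint, so the loop is simple. Both segments are counted as part of \<open>A\<close>.\<close>

lemma simple_loop_through_two_pinches:
  fixes U V :: "complex set"
  assumes U: "open U" "connected U" and V: "open V" "connected V" and UV: "U \<inter> V = {}"
    and q: "q \<in> closure U \<inter> closure V" "q' \<in> closure U \<inter> closure V"
    and r: "r > 0" "cball q r \<inter> cball q' r = {}"
  obtains A B where "path A" "path B" "pathstart A = pathstart B" "pathfinish A = pathfinish B"
    "simple_path (A +++ reversepath B)" "path_image A \<subseteq> U \<union> cball q r \<union> cball q' r"
    "path_image B \<subseteq> V" "pathstart A \<in> cball q r" "pathfinish A \<in> cball q' r"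
proof -
  have ends: "\<exists>u\<in>W. u \<in> ball p r" if "p \<in> closure W" for p and W :: "complex set"
    using that r(1) closure_approachable[of p W] by (auto simp: dist_commute)
  obtain u u' v v' where uv: "u \<in> U" "u \<in> ball q r" "u' \<in> U" "u' \<in> ball q' r"
     "v \<in> V" "v \<in> ball q r" "v' \<in> V" "v' \<in> ball q' r"
    using ends[of q U] ends[of q' U] ends[of q V] ends[of q' V] q by auto
  have "ball q r \<inter> ball q' r = {}" using r by (meson ball_subset_cball disjoint_iff subsetD)
  then have "u \<noteq> u'" "v \<noteq> v'" using uv by auto
  have arcs: "\<exists>c. arc c \<and> path_image c \<subseteq> W \<and> pathstart c = s \<and> pathfinish c = t"
    if "open W" "connected W" "s \<in> W" "t \<in> W" "s \<noteq> t" for W s and t :: complex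
    using that connected_open_path_connected[of W] path_connected_arcwise[of W] by blast
  obtain a where a: "arc a" "path_image a \<subseteq> U" "pathstart a = u" "pathfinish a = u'"
    using arcs[OF U] uv \<open>u \<noteq> u'\<close> by blast
  obtain b where b: "arc b" "path_image b \<subseteq> V" "pathstart b = v" "pathfinish b = v'"
    using arcs[OF V] uv \<open>v \<noteq> v'\<close> by blast
  have cab: "compact (path_image a)" "compact (path_image b)"
    using a b by (simp_all add: arc_imp_path compact_path_image)
  have ab: "path_image a \<inter> path_image b = {}" using a b UV by auto
  have "u \<in> path_image a" "u' \<in> path_image a" "v \<in> path_image b" "v' \<in> path_image b"
    using a b by auto
  then have meets: "path_image a \<inter> ball q r \<noteq> {}" "path_image b \<inter> ball q r \<noteq> {}"
    "path_image a \<inter> ball q' r \<noteq> {}" "path_image b \<inter> ball q' r \<noteq> {}"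
    using uv by auto
  obtain x y where xy: "x \<in> path_image a" "y \<in> path_image b" "closed_segment x y \<subseteq> cball q r"
    "closed_segment x y \<inter> path_image a = {x}" "closed_segment x y \<inter> path_image b = {y}"
    using ball_crossing_segment[OF cab meets(1,2)] by metis
  obtain x' y' where xy': "x' \<in> path_image a" "y' \<in> path_image b" "closed_segment x' y' \<subseteq> cball q' r"
    "closed_segment x' y' \<inter> path_image a = {x'}" "closed_segment x' y' \<inter> path_image b = {y'}"
    using ball_crossing_segment[OF cab meets(3,4)] by metis
  have ne: "x \<noteq> x'" "y \<noteq> y'" "x \<noteq> y" "x' \<noteq> y'"
    using xy xy' r ab by auto
  have subarc: "\<exists>d. arc d \<and> path_image d \<subseteq> path_image c \<and> pathstart d = s \<and> pathfinish d = t"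
    if c: "arc c" "s \<in> path_image c" "t \<in> path_image c" "s \<noteq> t" for c :: "real \<Rightarrow> complex" and s t
  proof -
    obtain m n where mn: "m \<in> {0..1}" "n \<in> {0..1}" "c m = s" "c n = t"
      using c(2,3) unfolding path_image_def by blast
    then have "arc (subpath m n c)" using c by (intro arc_subpath_arc) auto
    then show ?thesis using mn by (intro exI[of _ "subpath m n c"]) (auto simp: path_image_subpath_subset)
  qed
  obtain \<alpha> where \<alpha>: "arc \<alpha>" "path_image \<alpha> \<subseteq> path_image a" "pathstart \<alpha> = x" "pathfinish \<alpha> = x'"
    using subarc[OF a(1) xy(1) xy'(1) ne(1)] by blast
  obtain \<beta> where \<beta>: "arc \<beta>" "path_image \<beta> \<subseteq> path_image b" "pathstart \<beta> = y" "pathfinish \<beta> = y'"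
    using subarc[OF b(1) xy(2) xy'(2) ne(2)] by blast
  define A where "A = linepath y x +++ \<alpha> +++ linepath x' y'"
  have segs: "closed_segment x y \<inter> closed_segment x' y' = {}" using xy(3) xy'(3) r by blast
  have disj: "path_image (linepath y x) \<inter> path_image \<alpha> \<subseteq> {x}" "path_image \<alpha> \<inter> path_image (linepath x' y') \<subseteq> {x'}"
    using xy xy' \<alpha> by (auto simp: closed_segment_commute)
  have arc2: "arc (\<alpha> +++ linepath x' y')"
    using \<alpha> ne disj by (intro arc_join) auto
  have arcA: "arc A"
    unfolding A_def using \<alpha> ne disj arc2 segs
    by (intro arc_join) (auto simp: path_image_join closed_segment_commute)
  have imA: "path_image A = closed_segment x y \<union> path_image \<alpha> \<union> closed_segment x' y'"
    using \<alpha> by (auto simp: A_def path_image_join closed_segment_commute)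
  have sA: "pathstart A = y" "pathfinish A = y'" by (auto simp: A_def)
  show thesis
  proof
    show "path A" "path \<beta>" using arcA \<beta> by (auto intro: arc_imp_path)
    show "pathstart A = pathstart \<beta>" "pathfinish A = pathfinish \<beta>" using \<beta> sA by auto
    show "simple_path (A +++ reversepath \<beta>)"
      using \<beta> arcA sA imA xy xy' \<alpha> ab
      by (intro simple_path_join_loop) (auto simp: arc_reversepath)
    show "path_image A \<subseteq> U \<union> cball q r \<union> cball q' r" using imA xy xy' \<alpha> a by auto
    show "path_image \<beta> \<subseteq> V" using \<beta> b by auto
    show "pathstart A \<in> cball q r" "pathfinish A \<in> cball q' r" using sA xy xy' by auto
  qed
qed

text \<open>Otherwise a Jordan curve through \<open>q\<close> and \<open>q'\<close>, with one arc in \<open>U\<close> and one in \<open>V\<close>, would wind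
  \<open>-1\<close> times around \<open>g1\<close> and \<open>1\<close> time around \<open>g2\<close>.\<close>

lemma barriers_order_pinches_alike:
  fixes U V :: "complex set"
  assumes U: "open U" "connected U" and V: "open V" "connected V" and UV: "U \<inter> V = {}"
    and q: "q \<in> closure U \<inter> closure V" "q' \<in> closure U \<inter> closure V"
    and b1: "barrier X1 Y1 g1 L1 U1" and d1: "L1 \<inter> U = {}" "U1 \<inter> V = {}"
    and b2: "barrier X2 Y2 g2 L2 U2" and d2: "L2 \<inter> U = {}" "U2 \<inter> V = {}"
    and s1: "connected_component (- (L1 \<union> U1)) q (Complex (- X1) (- Y1))"
        "connected_component (- (L1 \<union> U1)) q' (Complex X1 (- Y1))"
    and s2: "connected_component (- (L2 \<union> U2)) q (Complex X2 (- Y2))"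
    "connected_component (- (L2 \<union> U2)) q' (Complex (- X2) (- Y2))"
  shows False
proof -
  define O1 O2 where "O1 = - (L1 \<union> U1)" and "O2 = - (L2 \<union> U2)"
  have op: "open O1" "open O2" using b1 b2 unfolding O1_def O2_def barrier_def
    by (auto intro!: open_Compl closed_Un simp del: Compl_Un)
  have qO: "q \<in> O1 \<inter> O2" "q' \<in> O1 \<inter> O2"
    using s1 s2 connected_component_in unfolding O1_def O2_def by blast+
  \<comment> \<open>For \<open>q = q'\<close> the constant loop would already have winding number -1
    around \<open>g1\<close>.\<close>
  have ne: "q \<noteq> q'"
  proof
    assume eq: "q = q'"
    have "g1 \<in> L1" using b1 by (simp add: barrier_def)
    then have g: "g1 \<notin> path_image (linepath q q)" using qO(1) by (auto simp: O1_def)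
    have "winding_number (linepath q q +++ reversepath (linepath q q)) g1 = -1"
      using qO s1 eq by (intro winding_number_around_barrier[OF b1]) (auto simp: O1_def)
    moreover have "winding_number (linepath q q +++ reversepath (linepath q q)) g1 = 0"
      using g by (subst winding_number_join) (auto simp: winding_number_reversepath)
    ultimately show False by simp
  qed
  have "open (O1 \<inter> O2)" using op by auto
  then obtain r1 r2 where r12: "r1 > 0" "cball q r1 \<subseteq> O1 \<inter> O2" "r2 > 0" "cball q' r2 \<subseteq> O1 \<inter> O2"
    using qO open_contains_cball by metis
  define r where "r = min (min r1 r2) (dist q q' / 3)"
  have r: "r > 0" "cball q r \<subseteq> O1 \<inter> O2" "cball q' r \<subseteq> O1 \<inter> O2"
    using r12 ne by (auto simp: r_def)
  have "0 < dist q q'" "3 * r \<le> dist q q'" using ne by (auto simp: r_def)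
  then have "r + r < dist q q'" by linarith
  then have "cball q r \<inter> cball q' r = {}" by (intro disjoint_cballI)
  then obtain A B where AB: "path A" "path B" "pathstart A = pathstart B" "pathfinish A = pathfinish B"
    and simple: "simple_path (A +++ reversepath B)" and A: "path_image A \<subseteq> U \<union> cball q r \<union> cball q' r"
    and B: "path_image B \<subseteq> V" and ends: "pathstart A \<in> cball q r" "pathfinish A \<in> cball q' r"
    using simple_loop_through_two_pinches[OF U V UV q r(1)] by metis
  \<comment> \<open>The ends of the arcs lie in balls that miss both barriers, hence on the same
    sides as the pinches.\<close>
  have near: "connected_component W s x"
    if "connected_component W p x" "cball p r \<subseteq> W" "s \<in> cball p r" for W and p s x :: complex
  proof -
    have "connected_component W p s"
      unfolding connected_component_def using that r(1) by (intro exI[of _ "cball p r"]) auto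
    then show ?thesis using that(1) by (meson connected_component_sym connected_component_trans)
  qed
  have rO: "cball q r \<subseteq> O1" "cball q r \<subseteq> O2" "cball q' r \<subseteq> O1" "cball q' r \<subseteq> O2"
    using r by auto
  note s = s1[folded O1_def] s2[folded O2_def]
  note sides = near[OF s(1) rO(1) ends(1)] near[OF s(2) rO(3) ends(2)]
    near[OF s(3) rO(2) ends(1)] near[OF s(4) rO(4) ends(2)]
  have AL: "path_image A \<inter> L1 = {}" "path_image A \<inter> L2 = {}" and BU: "path_image B \<inter> U1 = {}" "path_image B \<inter> U2 = {}"
    using A B r d1 d2 by (auto simp: O1_def O2_def)
  have w1: "winding_number (A +++ reversepath B) g1 = -1"
    using AB AL(1) BU(1) sides(1,2) by (intro winding_number_around_barrier[OF b1]) (simp_all add: O1_def)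
  have gLU: "g1 \<in> L1" "g1 \<in> U1" "g2 \<in> L2" "g2 \<in> U2"
    using b1 b2 by (auto simp: barrier_def)
  have gA: "g1 \<notin> path_image A" "g2 \<notin> path_image A" "g1 \<notin> path_image B" "g2 \<notin> path_image B"
    using gLU AL BU by blast+
  \<comment> \<open>The second barrier has \<open>q'\<close> on its left, so the formula applies to
    the arcs run backwards, which changes the sign.\<close>
  have "winding_number (reversepath A +++ reversepath (reversepath B)) g2 = -1"
    using AB AL(2) BU(2) sides(3,4) by (intro winding_number_around_barrier[OF b2]) (simp_all add: O2_def)
  then have w2: "winding_number (A +++ reversepath B) g2 = 1"
  proof -
    have "winding_number (reversepath A +++ reversepath (reversepath B)) g2 = - winding_number A g2 + winding_number B g2"
      using gA AB by (simp add: winding_number_join winding_number_reversepath)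
    moreover have "winding_number (A +++ reversepath B) g2 = winding_number A g2 - winding_number B g2"
      using gA AB by (simp add: winding_number_join winding_number_reversepath)
    ultimately show ?thesis
      using \<open>winding_number (reversepath A +++ reversepath (reversepath B)) g2 = -1\<close> by algebra
  qed
  let ?c = "A +++ reversepath B"
  have loop: "path ?c" "pathfinish ?c = pathstart ?c" using AB by auto
  have "g \<in> inside (path_image ?c)" if "g \<notin> path_image A" "g \<notin> path_image B" "winding_number ?c g \<noteq> 0" for g
  proof -
    have "g \<notin> path_image ?c" using that AB by (simp add: path_image_join)
    moreover have "g \<notin> outside (path_image ?c)" using that winding_number_zero_in_outside[OF loop] by auto
    ultimately show ?thesis using inside_Un_outside[of "path_image ?c"] by blast
  qed
  then have "g1 \<in> inside (path_image ?c)" "g2 \<in> inside (path_image ?c)" using w1 w2 gA by auto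
  moreover have "(\<forall>z \<in> inside (path_image ?c). winding_number ?c z = 1) \<or> (\<forall>z \<in> inside (path_image ?c). winding_number ?c z = -1)"
    by (rule simple_closed_path_winding_number_inside[OF simple]) auto
  ultimately show False using w1 w2 by auto
qed

text \<open>Vertical rays extend the compact pieces to infinity. They start inside the strip between
  \<open>c1\<close> and \<open>c2\<close>, so the half-planes beyond it stay clear of the barrier;
  being connected, they serve as its two sides.\<close>

lemma barrier_from_compact:
  assumes L: "compact L" "connected L" and U: "compact U" "connected U"
    and g: "g \<in> L" "g \<in> U" and st: "s \<in> L" "t \<in> U"
    and c: "\<And>z. z \<in> L \<union> U \<Longrightarrow> c1 < Re z \<and> Re z < c2"
    and L'_def: "L' = L \<union> {z. Re z = Re s \<and> Im z \<le> Im s}"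
    and U'_def: "U' = U \<union> {z. Re z = Re t \<and> Im t \<le> Im z}"
  obtains X Y where "barrier X Y g L' U'"
    "\<And>w. Re w \<le> c1 \<Longrightarrow> connected_component (- (L' \<union> U')) w (Complex (- X) (- Y))"
    "\<And>w. Re w \<ge> c2 \<Longrightarrow> connected_component (- (L' \<union> U')) w (Complex X (- Y))"
proof -
  have c': "c1 < Re z \<and> Re z < c2" if "z \<in> L' \<union> U'" for z
    using that c st by (auto simp: L'_def U'_def)
  obtain R where R: "R > 0" "\<And>z. z \<in> L \<union> U \<Longrightarrow> norm z < R"
    using bounded_pos_less[of "L \<union> U"] compact_imp_bounded[OF L(1)] compact_imp_bounded[OF U(1)] by auto
  have imR: "\<bar>Im z\<bar> < R" if "z \<in> L \<union> U" for z
    using abs_Im_le_cmod[of z] R(2)[OF that] by linarith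
  define X where "X = \<bar>c1\<bar> + \<bar>c2\<bar>"
  have eq: "{z. Re z = Re s \<and> Im z \<le> Im s} = {z. Re z \<le> Re s} \<inter> {z. Re s \<le> Re z} \<inter> {z. Im z \<le> Im s}"
    "{z. Re z = Re t \<and> Im t \<le> Im z} = {z. Re z \<le> Re t} \<inter> {z. Re t \<le> Re z} \<inter> {z. Im t \<le> Im z}"
    by auto
  have ray: "connected {z. Re z = Re s \<and> Im z \<le> Im s}" "connected {z. Re z = Re t \<and> Im t \<le> Im z}"
    unfolding eq
    by (intro convex_connected convex_Int convex_halfspace_Re_le convex_halfspace_Re_ge
        convex_halfspace_Im_le convex_halfspace_Im_ge)+
  have rayc: "closed {z. Re z = Re s \<and> Im z \<le> Im s}" "closed {z. Re z = Re t \<and> Im t \<le> Im z}"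
    unfolding eq
    by (intro closed_Int closed_halfspace_Re_le closed_halfspace_Re_ge closed_halfspace_Im_le closed_halfspace_Im_ge)+
  have unb: "\<not> bounded L'" "\<not> bounded U'"
  proof -
    show "\<not> bounded L'"
    proof
      assume "bounded L'"
      then obtain B where B: "\<And>z. z \<in> L' \<Longrightarrow> norm z \<le> B" by (auto simp: bounded_iff)
      let ?z = "Complex (Re s) (- \<bar>Im s\<bar> - \<bar>B\<bar> - 1)"
      have "?z \<in> L'" by (auto simp: L'_def)
      then show False using B[of ?z] abs_Im_le_cmod[of ?z] by simp
    qed
    show "\<not> bounded U'"
    proof
      assume "bounded U'"
      then obtain B where B: "\<And>z. z \<in> U' \<Longrightarrow> norm z \<le> B" by (auto simp: bounded_iff)
      let ?z = "Complex (Re t) (\<bar>Im t\<bar> + \<bar>B\<bar> + 1)"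
      have "?z \<in> U'" by (auto simp: U'_def)
      then show False using B[of ?z] abs_Im_le_cmod[of ?z] by simp
    qed
  qed
  show thesis
  proof
    show "barrier X R g L' U'"
      unfolding barrier_def
    proof (intro conjI)
      show "closed L'" "closed U'" unfolding L'_def U'_def
        using L U rayc by (simp_all add: closed_Un compact_imp_closed)
      show "connected L'" unfolding L'_def using L ray st by (intro connected_Un) auto
      show "connected U'" unfolding U'_def using U ray st by (intro connected_Un) auto
      have re: "\<bar>Re z\<bar> < X" if "z \<in> L' \<union> U'" for z using c'[OF that] by (auto simp: X_def)
      have "Im z < R" if "z \<in> L'" for z
        using that imR[of z] imR[of s] st by (auto simp: L'_def)
      then show "L' \<subseteq> {z. \<bar>Re z\<bar> < X \<and> Im z < R}" using re by auto
      have "- R < Im z" if "z \<in> U'" for z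
        using that imR[of z] imR[of t] st by (auto simp: U'_def)
      then show "U' \<subseteq> {z. \<bar>Re z\<bar> < X \<and> - R < Im z}" using re by auto
    qed (use unb g in \<open>auto simp: L'_def U'_def\<close>)
    show "connected_component (- (L' \<union> U')) w (Complex (- X) (- R))" if "Re w \<le> c1" for w
      unfolding connected_component_def
    proof (intro exI[of _ "{z. Re z \<le> c1}"] conjI)
      show "connected {z. Re z \<le> c1}" by (intro convex_connected convex_halfspace_Re_le)
      show "{z. Re z \<le> c1} \<subseteq> - (L' \<union> U')" using c' by fastforce
    qed (use that in \<open>auto simp: X_def\<close>)
    show "connected_component (- (L' \<union> U')) w (Complex X (- R))" if "Re w \<ge> c2" for w
      unfolding connected_component_def
    proof (intro exI[of _ "{z. Re z \<ge> c2}"] conjI)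
      show "connected {z. Re z \<ge> c2}" by (intro convex_connected convex_halfspace_Re_ge)
      show "{z. Re z \<ge> c2} \<subseteq> - (L' \<union> U')" using c' by fastforce
    qed (use that in \<open>auto simp: X_def\<close>)
  qed
qed

subsection \<open>Upper and lower sets of a twisting flow\<close>

text \<open>An abstract form of the integer iterates of the lift. Translations by 1 and \<i>
  generate the deck group; the rule for \<i> records that the n-th power of the twist matrix shears
  by \<open>n * \<kappa>\<close>.\<close>

locale dehn_flow =
  fixes \<phi> :: "int \<Rightarrow> complex \<Rightarrow> complex" and \<kappa> \<rho> C :: real
  assumes flow_0: "\<phi> 0 z = z"
    and flow_add: "\<phi> (m + n) z = \<phi> m (\<phi> n z)"
    and flow_cont: "continuous_on UNIV (\<phi> n)"
    and flow_1: "\<phi> n (z + 1) = \<phi> n z + 1"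
    and flow_\<i>: "\<phi> n (z + \<i>) = \<phi> n z + of_real (n * \<kappa>) + \<i>"
    and twist: "\<kappa> \<noteq> 0"
    and irrational: "\<rho> \<notin> \<rat>"
    and deviation: "\<bar>Im (\<phi> n z) - Im z - n * \<rho>\<bar> \<le> C"
begin

lemma C_nonneg: "0 \<le> C"
  using deviation[of 0 0] by (simp add: flow_0)

lemma flow_of_nat: "\<phi> n (z + of_nat j) = \<phi> n z + of_nat j"
  by (induction j) (auto simp: flow_1 add.assoc[symmetric] add.commute[of 1])

lemma flow_of_int: "\<phi> n (z + of_int j) = \<phi> n z + of_int j"
proof (cases "j \<ge> 0")
  case True
  then show ?thesis using flow_of_nat[of n z "nat j"] by (simp add: of_nat_nat)
next
  case False
  then show ?thesis using flow_of_nat[of n "z + of_int j" "nat (- j)"] by (simp add: of_nat_nat algebra_simps)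
qed

lemma flow_inverse: "\<phi> (- n) (\<phi> n z) = z" "\<phi> n (\<phi> (- n) z) = z"
  using flow_add[of "- n" n z] flow_add[of n "- n" z] flow_0 by simp_all

lemma flow_of_nat_\<i>: "\<phi> n (z + of_nat j * \<i>) = \<phi> n z + of_real (of_nat j * n * \<kappa>) + of_nat j * \<i>"
proof (induction j)
  case (Suc j)
  have "\<phi> n (z + of_nat (Suc j) * \<i>) = \<phi> n ((z + of_nat j * \<i>) + \<i>)" by (simp add: algebra_simps)
  then show ?case unfolding flow_\<i> Suc by (simp add: algebra_simps)
qed simp

lemma flow_of_int_\<i>: "\<phi> n (z + of_int j * \<i>) = \<phi> n z + of_real (of_int j * n * \<kappa>) + of_int j * \<i>"
proof (cases "j \<ge> 0")
  case True
  then show ?thesis using flow_of_nat_\<i>[of n z "nat j"] by (simp add: of_nat_nat)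
next
  case False
  then show ?thesis using flow_of_nat_\<i>[of n "z + of_int j * \<i>" "nat (- j)"]
    by (simp add: of_nat_nat algebra_simps)
qed

lemma Im_flow_of_int_\<i>: "Im (\<phi> n (z + of_int j * \<i>)) = Im (\<phi> n z) + j"
  by (simp add: flow_of_int_\<i>)

section \<open>Upper sets\<close>

definition upper :: "real \<Rightarrow> complex set" where
  "upper r = (\<Union>n. {z. r + of_int n * \<rho> < Im (\<phi> n z)})"

lemma mem_upper: "z \<in> upper r \<longleftrightarrow> (\<exists>n. r + of_int n * \<rho> < Im (\<phi> n z))"
  by (simp add: upper_def)

lemma upper_antimono: "r \<le> s \<Longrightarrow> upper s \<subseteq> upper r"
  unfolding upper_def by (auto intro: order.strict_trans1 add_right_mono)

lemma upper_high: "r + C < Im z \<Longrightarrow> z \<in> upper r"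
  using C_nonneg by (auto simp: mem_upper flow_0 intro: exI[of _ 0])

lemma upper_not_low: "z \<in> upper r \<Longrightarrow> r - C < Im z"
proof -
  assume "z \<in> upper r"
  then obtain n where "r + of_int n * \<rho> < Im (\<phi> n z)" by (auto simp: mem_upper)
  then show ?thesis using deviation[of n z] by linarith
qed

lemma open_upper: "open (upper r)"
  unfolding upper_def using flow_cont by (intro open_UN ballI open_Collect_less continuous_intros) auto

text \<open>Each set of the union is the image of a half-plane under an iterate, and by the
  deviation bound all of them share the point of height \<open>r + C + 1\<close> on the imaginary
  axis.\<close>

lemma connected_upper: "connected (upper r)"
proof -
  let ?S = "\<lambda>n. {z. r + of_int n * \<rho> < Im (\<phi> n z)}"
  have "connected (?S n)" for n
  proof -
    have "?S n = \<phi> (- n) ` {z. Im z > r + of_int n * \<rho>}"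
      using flow_inverse[of n] by (auto simp: image_iff) (metis)
    moreover have "connected \<dots>"
      using flow_cont by (intro connected_continuous_image convex_connected convex_halfspace_Im_gt)
         (auto intro: continuous_on_subset)
    ultimately show ?thesis by simp
  qed
  moreover have "Complex 0 (r + C + 1) \<in> ?S n" for n
    using deviation[of n "Complex 0 (r + C + 1)"] by (simp; linarith)
  ultimately show ?thesis
    unfolding upper_def by (intro connected_Union) (auto, blast)
qed

text \<open>The union runs over all integers, so applying an iterate only reindexes it.\<close>

lemma flow_upper: "\<phi> n z \<in> upper (r + n * \<rho>) \<longleftrightarrow> z \<in> upper r"
proof
  assume "\<phi> n z \<in> upper (r + n * \<rho>)"
  then obtain k where "r + n * \<rho> + of_int k * \<rho> < Im (\<phi> (k + n) z)" by (auto simp: mem_upper flow_add)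
  then show "z \<in> upper r" by (auto simp: mem_upper algebra_simps intro!: exI[of _ "k + n"])
next
  assume "z \<in> upper r"
  then obtain k where "r + of_int k * \<rho> < Im (\<phi> ((k - n) + n) z)" by (auto simp: mem_upper)
  then show "\<phi> n z \<in> upper (r + n * \<rho>)"
    unfolding flow_add by (auto simp: mem_upper algebra_simps intro!: exI[of _ "k - n"])
qed

lemma of_int_upper: "z + of_int j \<in> upper r \<longleftrightarrow> z \<in> upper r"
  by (simp add: mem_upper flow_of_int)

lemma of_int_\<i>_upper: "z + of_int j * \<i> \<in> upper (r + of_int j) \<longleftrightarrow> z \<in> upper r"
  unfolding mem_upper Im_flow_of_int_\<i> by (simp add: algebra_simps)

section \<open>Lower sets\<close>

definition lower :: "real \<Rightarrow> complex set" where
  "lower r = connected_component_set (- closure (upper r)) (Complex 0 (r - C - 1))"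

lemma low_disjoint: "Im z < r - C \<Longrightarrow> z \<notin> closure (upper r)"
proof -
  have "upper r \<subseteq> {z. r - C \<le> Im z}" using upper_not_low by fastforce
  then have "closure (upper r) \<subseteq> {z. r - C \<le> Im z}"
    by (intro closure_minimal closed_halfspace_Im_ge)
  then show "Im z < r - C \<Longrightarrow> z \<notin> closure (upper r)" by auto
qed

lemma low_connected:
  assumes "Im z < r - C" "Im w < r - C"
  shows "connected_component (- closure (upper r)) z w"
  unfolding connected_component_def using assms low_disjoint
  by (intro exI[of _ "{z. Im z < r - C}"]) (auto simp: convex_connected convex_halfspace_Im_lt)

text \<open>All points below height \<open>r - C\<close> lie in one component, so any of them can
  replace the base point of the definition.\<close>

lemma mem_lower: "z \<in> lower r \<longleftrightarrow> (\<exists>w. Im w < r - C \<and> connected_component (- closure (upper r)) z w)"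
proof -
  let ?w = "Complex 0 (r - C - 1)"
  have w: "Im ?w < r - C" by simp
  show ?thesis
    unfolding lower_def mem_Collect_eq
    using w low_connected[OF _ w] connected_component_sym connected_component_trans by blast
qed

lemma lower_low: "Im z < r - C \<Longrightarrow> z \<in> lower r"
  using low_connected mem_lower by blast

lemma open_lower: "open (lower r)"
  unfolding lower_def by (intro open_connected_component) auto

lemma connected_lower: "connected (lower r)"
  unfolding lower_def by (rule connected_connected_component)

lemma lower_Int_closure_upper: "lower r \<inter> closure (upper r) = {}"
  unfolding lower_def using connected_component_subset by blast

lemma lower_Int_upper: "r \<le> s \<Longrightarrow> lower r \<inter> upper s = {}"
  using lower_Int_closure_upper[of r] closure_subset[of "upper r"] upper_antimono[of r s] by blast

lemma lower_not_high: "z \<in> lower r \<Longrightarrow> Im z \<le> r + C"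
  using lower_Int_upper[of r r] upper_high[of r z] by force

lemma lower_maximal:
  assumes "connected T" "T \<inter> closure (upper r) = {}" "w \<in> T" "Im w < r - C"
  shows "T \<subseteq> lower r"
  unfolding subset_iff mem_lower connected_component_def using assms by auto

lemma lower_mono:
  assumes "r \<le> s"
  shows "lower r \<subseteq> lower s"
proof (rule lower_maximal)
  show "lower r \<inter> closure (upper s) = {}"
    using lower_Int_closure_upper[of r] closure_mono[OF upper_antimono[OF assms]] by auto
  show "Complex 0 (r - C - 1) \<in> lower r" by (rule lower_low) simp
qed (use assms connected_lower in auto)

text \<open>The map \<open>T\<close> is kept abstract to cover iterates combined with vertical
  translations, their inverses, and horizontal translations. A homeomorphism that respects the upper
  sets permutes the complementary components, and the bound ensures that the low one goes to a low
  one.\<close>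

lemma equivariance:
  assumes T: "continuous_on UNIV T" and S: "continuous_on UNIV S" and ST: "\<And>z. S (T z) = z" and TS: "\<And>z. T (S z) = z"
    and bound: "\<And>z. \<bar>Im (T z) - Im z - s\<bar> \<le> C"
    and up: "\<And>z r. T z \<in> upper (r + s) \<longleftrightarrow> z \<in> upper r"
  shows "z \<in> closure (upper r) \<Longrightarrow> T z \<in> closure (upper (r + s))"
    and "z \<in> lower r \<Longrightarrow> T z \<in> lower (r + s)"
    and "z \<in> closure (lower r) \<Longrightarrow> T z \<in> closure (lower (r + s))"
proof -
  have cl: "f x \<in> closure B" if "continuous_on UNIV f" "x \<in> closure A" "f ` A \<subseteq> B"
    for f :: "complex \<Rightarrow> complex" and x A B
  proof -
    have "f ` closure A \<subseteq> closure B"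
      using that closure_subset[of B] by (intro image_closure_subset) (auto intro: continuous_on_subset)
    then show ?thesis using that(2) by auto
  qed
  show "z \<in> closure (upper r) \<Longrightarrow> T z \<in> closure (upper (r + s))" for z r
    by (rule cl[OF T]) (auto simp: up)
  have lo: "T ` lower r \<subseteq> lower (r + s)" for r
  proof (rule lower_maximal)
    \<comment> \<open>Below \<open>r\<close> by more than \<open>2 * C\<close>: one \<open>C\<close>
      to lie in \<open>lower r\<close>, another to stay low after applying \<open>T\<close>.\<close>
    let ?w = "Complex 0 (r - 2 * C - 1)"
    show "connected (T ` lower r)"
      using connected_lower T by (blast intro: connected_continuous_image continuous_on_subset)
    show "T ?w \<in> T ` lower r"
      using C_nonneg by (intro imageI lower_low) simp
    show "Im (T ?w) < r + s - C" using bound[of ?w] by simp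
    have "z \<in> closure (upper r)" if "T z \<in> closure (upper (r + s))" for z
    proof -
      have "x \<in> T ` upper r" if "x \<in> upper (r + s)" for x
        using up[of "S x"] that TS[of x] by (metis image_eqI)
      then have "S ` upper (r + s) \<subseteq> upper r" using ST by force
      from cl[OF S that this] show ?thesis by (simp add: ST)
    qed
    then show "T ` lower r \<inter> closure (upper (r + s)) = {}"
      using lower_Int_closure_upper[of r] by auto
  qed
  then show "z \<in> lower r \<Longrightarrow> T z \<in> lower (r + s)" for z r by auto
  show "z \<in> closure (lower r) \<Longrightarrow> T z \<in> closure (lower (r + s))" for z r
    by (rule cl[OF T]) (use lo in auto)
qed

section \<open>Recurrence of the rotation and the level-shifting maps\<close>

lemma dense_rotation:
  assumes "\<epsilon> > 0"
  obtains n m :: int where "\<bar>n * \<rho> + m - x\<bar> < \<epsilon>"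
proof -
  obtain h k :: int where "\<bar>of_int k * \<rho> - of_int h - x\<bar> < \<epsilon>"
    using sequence_of_fractional_parts_is_dense[OF irrational assms, of x] by metis
  then show thesis using that[of k "- h"] by simp
qed

text \<open>Fractions \<open>h / k\<close> that approximate \<rho> to within \<open>1 / k^2\<close>
  have arbitrarily large denominators; then \<open>k * \<rho>\<close> is within \<open>1 / k\<close>
  of an integer.\<close>

lemma near_integer_rotation:
  assumes "\<epsilon> > 0"
  obtains n m :: int where "n > K" "\<bar>n * \<rho> + m\<bar> < \<epsilon>"
proof -
  have "infinite (approx_set \<rho>)"
    using irrational rational_iff_finite_approx_set by blast
  then obtain h k where hk: "(h, k) \<in> approx_set \<rho>" "k > max K \<lceil>1 / \<epsilon>\<rceil>"
    using infinite_approx_set by blast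
  then have k: "k > 0" "\<bar>\<rho> - of_int h / of_int k\<bar> < 1 / (of_int k)\<^sup>2" by (auto simp: approx_set_def)
  have "\<bar>of_int k * \<rho> - of_int h\<bar> = of_int k * \<bar>\<rho> - of_int h / of_int k\<bar>"
    using k(1) abs_mult[of "of_int k" "\<rho> - of_int h / of_int k"] by (simp add: right_diff_distrib)
  also have "\<dots> < of_int k * (1 / (of_int k)\<^sup>2)"
    using k by (intro mult_strict_left_mono) auto
  also have "\<dots> = 1 / of_int k" using k(1) by (simp add: power2_eq_square)
  also have "\<dots> < \<epsilon>"
  proof -
    have "1 / \<epsilon> < of_int k" using hk(2) by (simp add: ceiling_less_iff)
    then show ?thesis using assms k(1) by (simp add: field_simps)
  qed
  finally show thesis using that[of k "- h"] hk(2) by simp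
qed

text \<open>The vertical translation turns the level change of an iterate into
  \<open>n * \<rho> + m\<close>. These numbers are dense, and the small ones belong to maps that
  almost preserve levels.\<close>

definition shift :: "int \<Rightarrow> int \<Rightarrow> complex \<Rightarrow> complex" where
  "shift n m z = \<phi> n z + of_int m * \<i>"

lemma shift_equivariance:
  shows "z \<in> closure (upper r) \<Longrightarrow> shift n m z \<in> closure (upper (r + (n * \<rho> + m)))"
    and "shift n m z \<in> lower (r + (n * \<rho> + m)) \<longleftrightarrow> z \<in> lower r"
    and "z \<in> closure (lower r) \<Longrightarrow> shift n m z \<in> closure (lower (r + (n * \<rho> + m)))"
    and "shift n m z \<in> upper (r + (n * \<rho> + m)) \<longleftrightarrow> z \<in> upper r"
proof -
  have up: "shift n m z \<in> upper (r + (n * \<rho> + m)) \<longleftrightarrow> z \<in> upper r" for z r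
    using of_int_\<i>_upper[of "\<phi> n z" m "r + n * \<rho>"] by (simp add: shift_def flow_upper add.assoc)
  have cT: "continuous_on UNIV (shift n m)"
    unfolding shift_def by (intro continuous_intros flow_cont)
  define S where "S z = \<phi> (- n) (z - of_int m * \<i>)" for z
  have cS: "continuous_on UNIV S"
    unfolding S_def by (intro continuous_on_compose2[OF flow_cont] continuous_intros) auto
  have ST: "S (shift n m z) = z" "shift n m (S z) = z" for z
    by (simp_all add: shift_def S_def flow_inverse)
  have bound: "\<bar>Im (shift n m z) - Im z - (n * \<rho> + m)\<bar> \<le> C" for z
    using deviation[of n z] by (simp add: shift_def)
  note eq = equivariance[where T="shift n m" and S=S and s="n * \<rho> + m", OF cT cS ST bound up]
  let ?s = "n * \<rho> + m"
  \<comment> \<open>The inverse \<open>S\<close> satisfies the same hypotheses with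
    \<open>- ?s\<close>, which gives the converse for the lower sets.\<close>
  have boundS: "\<bar>Im (S z) - Im z - (- ?s)\<bar> \<le> C" for z
    using bound[of "S z"] unfolding ST by linarith
  have upS: "S z \<in> upper (r + - ?s) \<longleftrightarrow> z \<in> upper r" for z r
    using up[of "S z" "r + - ?s"] unfolding ST by (simp add: add.assoc)
  have "z \<in> lower r" if "shift n m z \<in> lower (r + ?s)"
    using equivariance(2)[where T=S and S="shift n m", OF cS cT ST(2,1) boundS upS that] by (simp add: ST)
  then show "shift n m z \<in> lower (r + ?s) \<longleftrightarrow> z \<in> lower r" using eq(2) by blast
  show "z \<in> closure (upper r) \<Longrightarrow> shift n m z \<in> closure (upper (r + ?s))"
    "z \<in> closure (lower r) \<Longrightarrow> shift n m z \<in> closure (lower (r + ?s))"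
    "shift n m z \<in> upper (r + ?s) \<longleftrightarrow> z \<in> upper r"
    by (fact eq up)+
qed

lemma of_int_equivariance:
  shows "z \<in> closure (upper r) \<Longrightarrow> z + of_int j \<in> closure (upper r)"
    and "z \<in> lower r \<Longrightarrow> z + of_int j \<in> lower r"
    and "z \<in> closure (lower r) \<Longrightarrow> z + of_int j \<in> closure (lower r)"
proof -
  have "continuous_on UNIV (\<lambda>z. z + of_int j :: complex)" "continuous_on UNIV (\<lambda>z. z - of_int j :: complex)"
    by (intro continuous_intros)+
  note eq = equivariance[OF this, of 0 z r]
  show "z \<in> closure (upper r) \<Longrightarrow> z + of_int j \<in> closure (upper r)"
    "z \<in> lower r \<Longrightarrow> z + of_int j \<in> lower r"
    "z \<in> closure (lower r) \<Longrightarrow> z + of_int j \<in> closure (lower r)"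
    using eq C_nonneg by (simp_all add: of_int_upper)
qed

text \<open>Equality at one pair of levels spreads along the dense orbit, so that every lower set
  lies in a lower set at least \<open>d / 2\<close> further down. Iterating this pushes
  \<open>lower 0\<close> below every height.\<close>

lemma lower_eq_imp_less:
  assumes "a < b"
  shows "lower a \<noteq> lower b"
proof
  assume eq: "lower a = lower b"
  define d where "d = b - a"
  have d: "d > 0" using assms by (simp add: d_def)
  have step: "lower c \<subseteq> lower (c - d / 2)" for c
  proof -
    \<comment> \<open>This target puts \<open>a + s\<close> between \<open>c - d\<close> and
      \<open>c - d / 2\<close>, hence \<open>b + s\<close> between \<open>c\<close> and
      \<open>c + d / 2\<close>.\<close>
    obtain n m :: int where nm: "\<bar>n * \<rho> + m - (c - 3 * d / 4 - a)\<bar> < d / 4"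
      using dense_rotation[of "d / 4"] d by auto
    define s where "s = n * \<rho> + m"
    have bs: "c \<le> b + s" "a + s \<le> c - d / 2"
      using nm by (auto simp: s_def d_def abs_less_iff field_simps)
    have "z \<in> lower (a + s)" if z: "z \<in> lower (b + s)" for z
    proof -
      define w where "w = \<phi> (- n) (z - of_int m * \<i>)"
      have zw: "z = shift n m w" by (simp add: w_def shift_def flow_inverse)
      have "w \<in> lower a" using z unfolding zw s_def shift_equivariance(2) eq .
      then show ?thesis unfolding zw s_def shift_equivariance(2) .
    qed
    then have "lower (b + s) \<subseteq> lower (a + s)" by auto
    then show ?thesis using lower_mono bs by blast
  qed
  have "lower 0 \<subseteq> lower (- (real j * d / 2))" for j
  proof (induction j)
    case (Suc j)
    have "- (real (Suc j) * d / 2) = - (real j * d / 2) - d / 2" by (simp add: field_simps)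
    then show ?case using step[of "- (real j * d / 2)"] Suc by simp
  qed simp
  moreover have "Complex 0 (- C - 1) \<in> lower 0" by (rule lower_low) simp
  ultimately have "- C - 1 \<le> - (real j * d / 2) + C" for j
    using lower_not_high by (metis complex.sel(2) subsetD)
  moreover obtain j where "real j > (2 * C + 1) / (d / 2)" using reals_Archimedean2 by blast
  ultimately show False using d by (simp add: field_simps) (smt (verit))
qed

subsection \<open>Pinches are spread by a bounded amount\<close>

definition pinch :: "real \<Rightarrow> real \<Rightarrow> complex set" where
  "pinch a b = closure (lower a) \<inter> closure (upper b)"

lemma pinch_mono: "a \<le> a' \<Longrightarrow> b' \<le> b \<Longrightarrow> pinch a b \<subseteq> pinch a' b'"
  unfolding pinch_def using closure_mono lower_mono upper_antimono by (meson Int_mono)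

lemma shift_pinch: "z \<in> pinch a b \<Longrightarrow> shift n m z \<in> pinch (a + (n * \<rho> + m)) (b + (n * \<rho> + m))"
  using shift_equivariance by (auto simp: pinch_def)

lemma of_int_pinch: "z \<in> pinch a b \<Longrightarrow> z + of_int j \<in> pinch a b"
  using of_int_equivariance by (auto simp: pinch_def)

text \<open>If they were disjoint, the open connected set \<open>lower b\<close> would miss
  \<open>closure (upper a)\<close> and thus lie in \<open>lower a\<close>, making the two lower sets
  equal.\<close>

lemma lower_meets_upper:
  assumes "a < b"
  shows "lower b \<inter> upper a \<noteq> {}"
proof
  assume "lower b \<inter> upper a = {}"
  then have "lower b \<inter> closure (upper a) = {}"
    using open_lower by (simp add: open_Int_closure_eq_empty)
  then have "lower b \<subseteq> lower a"
    using connected_lower assms lower_low[of "Complex 0 (a - C - 1)" b]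
    by (intro lower_maximal[where w="Complex 0 (a - C - 1)"]) auto
  then show False using lower_eq_imp_less[OF assms] lower_mono[of a b] assms by auto
qed

text \<open>The two open connected sets share a point \<open>g\<close> and reach the far bottom and
  the far top, so paths inside them supply the two halves of a barrier.\<close>

lemma path_through_gap:
  assumes "a < b" "- Y < b - C" "a + C < Y"
  obtains L U g where "compact L" "connected L" "L \<subseteq> lower b" "compact U" "connected U" "U \<subseteq> upper a"
    "g \<in> L" "g \<in> U" "Complex 0 (- Y) \<in> L" "Complex 0 Y \<in> U"
proof -
  obtain g where g: "g \<in> lower b" "g \<in> upper a" using lower_meets_upper[OF assms(1)] by auto
  have *: "\<exists>K. compact K \<and> connected K \<and> K \<subseteq> W \<and> g \<in> K \<and> w \<in> K"
    if "open W" "connected W" "g \<in> W" "w \<in> W" for W :: "complex set" and w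
  proof -
    have "path_connected W" using that connected_open_path_connected by blast
    then obtain p where "path p" "path_image p \<subseteq> W" "pathstart p = g" "pathfinish p = w"
      using \<open>g \<in> W\<close> \<open>w \<in> W\<close> unfolding path_connected_def by meson
    then show ?thesis
      by (intro exI[of _ "path_image p"]) (auto simp: compact_path_image connected_path_image)
  qed
  have "Complex 0 (- Y) \<in> lower b" "Complex 0 Y \<in> upper a"
    using assms by (auto intro!: lower_low upper_high)
  then obtain L U where "compact L \<and> connected L \<and> L \<subseteq> lower b \<and> g \<in> L \<and> Complex 0 (- Y) \<in> L"
    "compact U \<and> connected U \<and> U \<subseteq> upper a \<and> g \<in> U \<and> Complex 0 Y \<in> U"
    using *[OF open_lower connected_lower g(1)] *[OF open_upper connected_upper g(2)] by meson
  then show thesis using that by blast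
qed

lemma shift_of_int: "shift n m (z + of_int j) = shift n m z + of_int j"
  by (simp add: shift_def flow_of_int)

lemma shift_cont: "continuous_on S (shift n m)"
  unfolding shift_def by (intro continuous_intros continuous_on_subset[OF flow_cont]) auto

lemma inj_shift: "inj (shift n m)"
  by (rule injI) (metis add_right_cancel flow_inverse(1) shift_def)

text \<open>If \<open>\<phi> n p'\<close> were far to the right of \<open>\<phi> n p\<close>, a translate of a fixed barrier would separate them,
  and the image under \<open>\<phi> n\<close> of another translate would separate them in the opposite order (after moving
  \<open>p\<close> by \<open>J\<close>). The vertical ends of the barrier are not mapped but added again afterwards, so that
  the image is horizontally bounded.\<close>

lemma pinch_displacement_bounded_above:
  assumes ab: "a < b" and e: "\<eta> > 0" and p: "p \<in> pinch (a - 2 * \<eta>) (b + 2 * \<eta>)" "p' \<in> pinch (a - 2 * \<eta>) (b + 2 * \<eta>)"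
  obtains M where "\<And>n m :: int. \<bar>n * \<rho> + m\<bar> < \<eta> \<Longrightarrow> Re (\<phi> n p') - Re (\<phi> n p) \<le> M"
proof -
  \<comment> \<open>\<open>Y\<close> is so large that ends moved by up to \<open>C + \<eta>\<close>
    still carry rays inside the required lower and upper sets, away from the images of points at the
    heights of \<open>p\<close> and \<open>p'\<close>.\<close>
  define Y where "Y = \<bar>a\<bar> + \<bar>b\<bar> + \<bar>Im p\<bar> + \<bar>Im p'\<bar> + 2 * \<eta> + 2 * C + 1"
  obtain L U g where LU: "compact L" "connected L" "L \<subseteq> lower b" "compact U" "connected U" "U \<subseteq> upper a"
    and g: "g \<in> L" "g \<in> U" and st: "Complex 0 (- Y) \<in> L" "Complex 0 Y \<in> U"
  proof (rule path_through_gap[OF ab])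
    show "- Y < b - C" "a + C < Y" using e C_nonneg by (auto simp: Y_def)
  qed
  obtain c where c: "c > 0" "\<And>z. z \<in> L \<union> U \<Longrightarrow> norm z < c"
    using bounded_pos_less[of "L \<union> U"] compact_imp_bounded[OF LU(1)] compact_imp_bounded[OF LU(4)] by auto
  have cRe: "\<bar>Re z\<bar> < c" if "z \<in> L \<union> U" for z
    using abs_Re_le_cmod[of z] c(2)[OF that] by linarith
  \<comment> \<open>The barrier translated by \<open>j0\<close> is to the right of
    \<open>p'\<close>, and \<open>p\<close> translated by \<open>J\<close> is to the right of that
    barrier.\<close>
  define j0 where "j0 = \<lceil>Re p' + c\<rceil>"
  define J where "J = \<lceil>c + j0 - Re p\<rceil>"
  have j0: "Re p' + c \<le> j0" and J: "c + j0 \<le> Re p + J" unfolding j0_def J_def by linarith+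
  \<comment> \<open>\<open>J\<close> accounts for the move of \<open>p\<close>, \<open>2 * c\<close>
    for the width of the barrier, and 2 for rounding its position to an integer.\<close>
  have "Re (\<phi> n p') - Re (\<phi> n p) \<le> J + 2 * c + 2" if nm: "\<bar>n * \<rho> + m\<bar> < \<eta>" for n m :: int
  proof (rule ccontr)
    assume far: "\<not> ?thesis"
    define F where "F = shift n m"
    define q q' where "q = F p + of_int J" and "q' = F p'"
    have Re_q: "Re q = Re (\<phi> n p) + J" "Re q' = Re (\<phi> n p')" by (simp_all add: q_def q'_def F_def shift_def)
    have ImF: "\<bar>Im (F z) - Im z\<bar> \<le> C + \<eta>" for z
      using deviation[of n z] nm by (simp add: F_def shift_def; linarith)
    \<comment> \<open>\<open>F\<close> changes levels by less than \<open>\<eta>\<close>. Of the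
      margin \<open>2 * \<eta>\<close>, one half absorbs this for the pinches and the other half for
      the barriers.\<close>
    have Fp: "F z \<in> pinch (a - \<eta>) (b + \<eta>)" if "z \<in> pinch (a - 2 * \<eta>) (b + 2 * \<eta>)" for z
      unfolding F_def using nm
      by (intro subsetD[OF pinch_mono shift_pinch[OF that, of n m]]) (auto simp: abs_less_iff)
    have qP: "q \<in> pinch (a - \<eta>) (b + \<eta>)" "q' \<in> pinch (a - \<eta>) (b + \<eta>)"
      unfolding q_def q'_def using Fp p of_int_pinch by auto
    note lo = subsetD[OF lower_mono] and up = subsetD[OF upper_antimono]
    have Flow: "F z \<in> lower (b + \<eta>)" if "z \<in> lower b" for z
      using that shift_equivariance(2)[of n m z b] nm unfolding F_def
      by (intro lo[of "b + (n * \<rho> + m)" "b + \<eta>"]) auto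
    have Fup: "F z \<in> upper (a - \<eta>)" if "z \<in> upper a" for z
      using that shift_equivariance(4)[of n m z a] nm unfolding F_def
      by (intro up[of "a - \<eta>" "a + (n * \<rho> + m)"]) auto
    define j where "j = \<lceil>Re q + c\<rceil>"
    have j: "Re q \<le> j - c" "j + c \<le> Re q'"
      using far unfolding Re_q j_def by linarith+
    let ?t = "\<lambda>i z. z + of_int i :: complex"
    have trans: "compact (?t i ` K)" if "compact K" for i and K :: "complex set"
      using that by (intro compact_continuous_image continuous_intros)
    have transc: "connected (?t i ` K)" if "connected K" for i and K :: "complex set"
      using that by (intro connected_continuous_image continuous_intros)
    define L1 where "L1 = ?t j ` L \<union> {z. Re z = Re (?t j (Complex 0 (- Y))) \<and> Im z \<le> Im (?t j (Complex 0 (- Y)))}"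
    define U1 where "U1 = ?t j ` U \<union> {z. Re z = Re (?t j (Complex 0 Y)) \<and> Im (?t j (Complex 0 Y)) \<le> Im z}"
    have bd1: "- c + j < Re z \<and> Re z < c + j" if "z \<in> ?t j ` L \<union> ?t j ` U" for z
      using that cRe by (force simp: abs_less_iff)
    obtain X1 Y1 where b1: "barrier X1 Y1 (?t j g) L1 U1"
      and s1: "\<And>w. Re w \<le> - c + j \<Longrightarrow> connected_component (- (L1 \<union> U1)) w (Complex (- X1) (- Y1))"
      "\<And>w. Re w \<ge> c + j \<Longrightarrow> connected_component (- (L1 \<union> U1)) w (Complex X1 (- Y1))"
      by (rule barrier_from_compact[OF trans[OF LU(1)] transc[OF LU(2)] trans[OF LU(4)] transc[OF LU(5)]
        imageI[OF g(1)] imageI[OF g(2)] imageI[OF st(1)] imageI[OF st(2)] bd1 L1_def U1_def]) (assumption | rule that)+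
    have Ybd: "Im z \<le> - Y + C + \<eta> \<Longrightarrow> z \<in> lower (b + \<eta>)" "Y - C - \<eta> \<le> Im z \<Longrightarrow> z \<in> upper (a - \<eta>)" for z
      using e C_nonneg by (auto intro!: lower_low upper_high simp: Y_def)
    have "L1 \<subseteq> lower (b + \<eta>)"
      unfolding L1_def using LU(3) of_int_equivariance(2) lo[of b "b + \<eta>"] e Ybd(1) C_nonneg by auto
    moreover have "U1 \<subseteq> upper (a - \<eta>)"
      unfolding U1_def using LU(6) of_int_upper up[of "a - \<eta>" a] e Ybd(2) C_nonneg by auto
    ultimately have d1: "L1 \<inter> upper (b + \<eta>) = {}" "U1 \<inter> lower (a - \<eta>) = {}"
      using lower_Int_upper[of "b + \<eta>" "b + \<eta>"] lower_Int_upper[of "a - \<eta>" "a - \<eta>"] by auto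
    let ?G = "\<lambda>z. F (?t j0 z)"
    have Gc: "compact (?G ` K)" if "compact K" for K :: "complex set"
      using that unfolding F_def shift_of_int by (intro compact_continuous_image continuous_intros shift_cont)
    have Gcc: "connected (?G ` K)" if "connected K" for K :: "complex set"
      using that unfolding F_def shift_of_int by (intro connected_continuous_image continuous_intros shift_cont)
    define s t where "s = ?G (Complex 0 (- Y))" and "t = ?G (Complex 0 Y)"
    define L2 where "L2 = ?G ` L \<union> {z. Re z = Re s \<and> Im z \<le> Im s}"
    define U2 where "U2 = ?G ` U \<union> {z. Re z = Re t \<and> Im t \<le> Im z}"
    have Imst: "Im s \<le> - Y + C + \<eta>" "Y - C - \<eta> \<le> Im t"
      using ImF[of "?t j0 (Complex 0 (- Y))"] ImF[of "?t j0 (Complex 0 Y)"] by (auto simp: s_def t_def)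
    have "bounded (?G ` L \<union> ?G ` U)"
      using compact_imp_bounded[OF Gc[OF LU(1)]] compact_imp_bounded[OF Gc[OF LU(4)]] by (simp only: bounded_Un)
    then obtain B where B: "B > 0" "\<And>z. z \<in> ?G ` L \<union> ?G ` U \<Longrightarrow> norm z < B"
      unfolding bounded_pos_less by (elim exE conjE) (rule that, auto)
    have bd2: "- B < Re z \<and> Re z < B" if "z \<in> ?G ` L \<union> ?G ` U" for z
      using abs_Re_le_cmod[of z] B(2)[OF that] by linarith
    obtain X2 Y2 where b2: "barrier X2 Y2 (?G g) L2 U2"
      and s2: "\<And>w. Re w \<le> - B \<Longrightarrow> connected_component (- (L2 \<union> U2)) w (Complex (- X2) (- Y2))"
      "\<And>w. Re w \<ge> B \<Longrightarrow> connected_component (- (L2 \<union> U2)) w (Complex X2 (- Y2))"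
      by (rule barrier_from_compact[OF Gc[OF LU(1)] Gcc[OF LU(2)] Gc[OF LU(4)] Gcc[OF LU(5)]
        imageI[OF g(1)] imageI[OF g(2)] imageI[OF st(1)] imageI[OF st(2)] bd2 L2_def[unfolded s_def] U2_def[unfolded t_def]]) (assumption | rule that)+
    have "?G z \<in> lower (b + \<eta>)" if "z \<in> L" for z
      using that LU(3) by (intro Flow of_int_equivariance(2)) auto
    moreover have "?G z \<in> upper (a - \<eta>)" if "z \<in> U" for z
      using that LU(6) by (intro Fup) (auto simp: of_int_upper)
    ultimately have "L2 \<subseteq> lower (b + \<eta>)" "U2 \<subseteq> upper (a - \<eta>)"
      unfolding L2_def U2_def using Ybd Imst by force+
    then have d2: "L2 \<inter> upper (b + \<eta>) = {}" "U2 \<inter> lower (a - \<eta>) = {}"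
      using lower_Int_upper[of "b + \<eta>" "b + \<eta>"] lower_Int_upper[of "a - \<eta>" "a - \<eta>"] by auto
    \<comment> \<open>A horizontal segment missing the barrier at \<open>j0\<close> has an image
      missing the second barrier: injectivity of \<open>F\<close> handles the mapped pieces, the
      height estimate the attached rays.\<close>
    have avoid: "connected_component (- (L2 \<union> U2)) (F w) (F w')"
      if w: "Im w = Im w'" "\<bar>Im w\<bar> \<le> \<bar>Im p\<bar> + \<bar>Im p'\<bar>"
        and side: "\<And>z. z \<in> closed_segment w w' \<Longrightarrow> Re z \<le> j0 - c \<or> j0 + c \<le> Re z" for w w'
    proof -
      let ?T = "F ` closed_segment w w'"
      have "x \<notin> L2 \<union> U2" if "x \<in> ?T" for x
      proof -
        obtain z where z: "z \<in> closed_segment w w'" "x = F z" using \<open>x \<in> ?T\<close> by auto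
        have "Im z = Im w" using z(1) closed_segment_same_Im[OF w(1)] by auto
        then have "\<bar>Im x\<bar> < Y - C - \<eta>" using ImF[of z] w(2) z(2) e C_nonneg by (auto simp: Y_def)
        moreover have "x \<noteq> ?G y" if "y \<in> L \<union> U" for y
        proof
          assume "x = ?G y"
          then have "z = ?t j0 y" using z(2) inj_shift[THEN injD] by (auto simp: F_def)
          then show False using side[OF z(1)] cRe[OF that] by auto
        qed
        ultimately show ?thesis using Imst by (auto simp: L2_def U2_def)
      qed
      moreover have "connected ?T" unfolding F_def
        by (intro connected_continuous_image shift_cont) auto
      ultimately show ?thesis
        unfolding connected_component_def by (intro exI[of _ ?T]) auto
    qed
    \<comment> \<open>Moving the translate of \<open>p\<close> to the right and \<open>p'\<close> to
      the left by \<open>N\<close> avoids the strip around \<open>j0\<close>. As \<open>F\<close>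
      commutes with integer translations, the images end beyond \<open>B\<close>, so the second
      barrier has \<open>q\<close> on its right and \<open>q'\<close> on its left.\<close>
    obtain N :: nat where N: "real N > \<bar>Re q\<bar> + \<bar>Re q'\<bar> + B" using reals_Archimedean2 by blast
    have Fint: "F (z + of_int i) = F z + of_int i" for z i by (simp add: F_def shift_of_int)
    have "connected_component (- (L2 \<union> U2)) (F (?t J p)) (F (?t (int N) (?t J p)))"
    proof (rule avoid)
      fix z assume "z \<in> closed_segment (?t J p) (?t (int N) (?t J p))"
      then have "Re p + J \<le> Re z" by (auto simp: closed_segment_same_Im closed_segment_eq_real_ivl)
      then show "Re z \<le> j0 - c \<or> j0 + c \<le> Re z" using J by linarith
    qed auto
    moreover have "Re (F (?t (int N) (?t J p))) \<ge> B" using N unfolding Fint q_def by simp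
    ultimately have r2: "connected_component (- (L2 \<union> U2)) q (Complex X2 (- Y2))"
      using s2(2) connected_component_trans unfolding q_def Fint by blast
    have "connected_component (- (L2 \<union> U2)) (F p') (F (?t (- int N) p'))"
    proof (rule avoid)
      fix z assume "z \<in> closed_segment p' (?t (- int N) p')"
      then have "Re z \<le> Re p'" by (auto simp: closed_segment_same_Im closed_segment_eq_real_ivl split: if_splits)
      then show "Re z \<le> j0 - c \<or> j0 + c \<le> Re z" using j0 by linarith
    qed auto
    moreover have "Re (F (?t (- int N) p')) \<le> - B" using N unfolding Fint q'_def by simp
    ultimately have l2: "connected_component (- (L2 \<union> U2)) q' (Complex (- X2) (- Y2))"
      using s2(1) connected_component_trans unfolding q'_def by blast
    show False
    proof (rule barriers_order_pinches_alike[OF open_upper connected_upper open_lower connected_lower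
          _ _ _ b1 d1 b2 d2 s1(1) s1(2) r2 l2])
      show "upper (b + \<eta>) \<inter> lower (a - \<eta>) = {}"
        using lower_Int_upper[of "a - \<eta>" "b + \<eta>"] ab e by auto
    qed (use qP j in \<open>auto simp: pinch_def\<close>)
  qed
  then show thesis using that by blast
qed

subsection \<open>The height function\<close>

text \<open>Shifting one pinch along the dense orbit reaches almost any level; shrinking the gap
  from \<open>b - a\<close> to \<open>w\<close> absorbs the error.\<close>

lemma pinch_exists_at:
  assumes z: "z \<in> pinch a b" and "w < b - a"
  shows "\<exists>p. p \<in> pinch t (t + w)"
proof -
  define \<epsilon> where "\<epsilon> = (b - a - w) / 2"
  have e: "\<epsilon> > 0" using assms by (simp add: \<epsilon>_def)
  obtain n m :: int where nm: "\<bar>n * \<rho> + m - (t - a - \<epsilon>)\<bar> < \<epsilon>"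
    using dense_rotation[OF e] by blast
  have "shift n m z \<in> pinch (a + (n * \<rho> + m)) (b + (n * \<rho> + m))"
    by (rule shift_pinch[OF z])
  moreover have "a + (n * \<rho> + m) \<le> t" "t + w \<le> b + (n * \<rho> + m)"
    using nm unfolding abs_less_iff \<epsilon>_def by (auto simp: field_simps)
  ultimately show ?thesis using pinch_mono by blast
qed

text \<open>Only times at which \<open>n * \<rho>\<close> is close to an integer count, since then
  some \<open>shift n m\<close> almost preserves levels.\<close>

definition bounded_spread :: "real \<Rightarrow> complex \<Rightarrow> complex \<Rightarrow> bool" where
  "bounded_spread \<eta> p p' \<longleftrightarrow>
     (\<exists>M. \<forall>n m :: int. \<bar>n * \<rho> + m\<bar> < \<eta> \<longrightarrow> \<bar>Re (\<phi> n p') - Re (\<phi> n p)\<bar> \<le> M)"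

lemma bounded_spread_trans:
  assumes "bounded_spread \<eta> p q" "bounded_spread \<eta> q r"
  shows "bounded_spread \<eta> p r"
proof -
  obtain M M' where M: "\<And>n m :: int. \<bar>n * \<rho> + m\<bar> < \<eta> \<Longrightarrow> \<bar>Re (\<phi> n q) - Re (\<phi> n p)\<bar> \<le> M"
    "\<And>n m :: int. \<bar>n * \<rho> + m\<bar> < \<eta> \<Longrightarrow> \<bar>Re (\<phi> n r) - Re (\<phi> n q)\<bar> \<le> M'"
    using assms unfolding bounded_spread_def by metis
  have "\<bar>Re (\<phi> n r) - Re (\<phi> n p)\<bar> \<le> M + M'" if "\<bar>n * \<rho> + m\<bar> < \<eta>" for n m :: int
    using M[OF that] by linarith
  then show ?thesis unfolding bounded_spread_def by blast
qed

text \<open>Both points are pinches of the pair \<open>t + d\<close>, \<open>t + 4 * d\<close>. The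
  barrier uses the middle levels \<open>t + 2 * d\<close> and \<open>t + 3 * d\<close>, leaving a
  margin \<open>d = 2 * (d / 2)\<close> on each side.\<close>

lemma linked_pinches_bounded_spread:
  assumes d: "d > 0" and p: "p \<in> pinch t (t + 4 * d)" "p' \<in> pinch (t + d) (t + 5 * d)"
  shows "bounded_spread (d / 2) p p'"
proof -
  have P: "p \<in> pinch ((t + 2 * d) - 2 * (d / 2)) ((t + 3 * d) + 2 * (d / 2))"
    "p' \<in> pinch ((t + 2 * d) - 2 * (d / 2)) ((t + 3 * d) + 2 * (d / 2))"
    using p d by (auto intro: subsetD[OF pinch_mono, rotated 2])
  have ab: "t + 2 * d < t + 3 * d" and e: "d / 2 > 0" using d by auto
  obtain M where M: "\<And>n m :: int. \<bar>n * \<rho> + m\<bar> < d / 2 \<Longrightarrow> Re (\<phi> n p') - Re (\<phi> n p) \<le> M"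
    using pinch_displacement_bounded_above[OF ab e P] by blast
  obtain M' where M': "\<And>n m :: int. \<bar>n * \<rho> + m\<bar> < d / 2 \<Longrightarrow> Re (\<phi> n p) - Re (\<phi> n p') \<le> M'"
    using pinch_displacement_bounded_above[OF ab e P(2,1)] by blast
  have "\<bar>Re (\<phi> n p') - Re (\<phi> n p)\<bar> \<le> max M M'" if "\<bar>n * \<rho> + m\<bar> < d / 2" for n m :: int
    using M[OF that] M'[OF that] by linarith
  then show ?thesis unfolding bounded_spread_def by blast
qed

text \<open>The twist separates the two points horizontally by exactly \<open>n * \<kappa>\<close>,
  and admissible \<open>n\<close> are arbitrarily large.\<close>

lemma not_bounded_spread_vertical:
  assumes "\<eta> > 0"
  shows "\<not> bounded_spread \<eta> p (p + \<i>)"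
proof
  assume "bounded_spread \<eta> p (p + \<i>)"
  then obtain M where M: "\<And>n m :: int. \<bar>n * \<rho> + m\<bar> < \<eta> \<Longrightarrow> \<bar>Re (\<phi> n (p + \<i>)) - Re (\<phi> n p)\<bar> \<le> M"
    unfolding bounded_spread_def by blast
  obtain n m :: int where nm: "n > max 0 \<lceil>M / \<bar>\<kappa>\<bar>\<rceil>" "\<bar>n * \<rho> + m\<bar> < \<eta>"
    using near_integer_rotation[OF assms] by metis
  have "\<bar>real_of_int n * \<kappa>\<bar> \<le> M" using M[OF nm(2)] by (simp add: flow_\<i>)
  then have "real_of_int n * \<bar>\<kappa>\<bar> \<le> M" using nm(1) by (simp add: abs_mult)
  moreover have "M / \<bar>\<kappa>\<bar> < real_of_int n" using nm(1) by (simp add: ceiling_less_iff)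
  ultimately show False using twist by (simp add: field_simps)
qed

lemma pinch_empty:
  assumes "a < b"
  shows "pinch a b = {}"
proof (rule ccontr)
  assume "pinch a b \<noteq> {}"
  then obtain z where z: "z \<in> pinch a b" by blast
  obtain N :: nat where N: "real N > 4 / (b - a)" using reals_Archimedean2 by blast
  then have N0: "N > 0" using assms by (cases N) (auto simp: field_simps)
  \<comment> \<open>\<open>N\<close> steps of size \<open>d\<close> climb from level 0 to level 1,
    and \<open>4 * d < b - a\<close> provides pinches of gap \<open>4 * d\<close> at every
    level.\<close>
  define d where "d = 1 / real N"
  have d: "d > 0" "real N * d = 1" "4 * d < b - a"
    using N N0 assms by (auto simp: d_def field_simps)
  obtain z0 where z0: "z0 \<in> pinch 0 (4 * d)"
    using pinch_exists_at[OF z d(3), of 0] by auto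
  have chain: "bounded_spread (d / 2) z0 w" if "w \<in> pinch (real (Suc i) * d) (real (Suc i) * d + 4 * d)" for i w
    using that
  proof (induction i arbitrary: w)
    case 0
    then show ?case using linked_pinches_bounded_spread[of d z0 0 w] z0 d by (simp add: field_simps)
  next
    case (Suc i)
    obtain p where p: "p \<in> pinch (real (Suc i) * d) (real (Suc i) * d + 4 * d)"
      using pinch_exists_at[OF z d(3)] by blast
    have eq: "real (Suc (Suc i)) * d = real (Suc i) * d + d" by (simp add: field_simps)
    have "w \<in> pinch (real (Suc i) * d + d) (real (Suc i) * d + 5 * d)"
      using Suc.prems unfolding eq by (simp add: add.assoc)
    then have "bounded_spread (d / 2) p w" by (rule linked_pinches_bounded_spread[OF d(1) p])
    then show ?case using Suc.IH[OF p] bounded_spread_trans by blast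
  qed
  have "z0 + \<i> \<in> pinch 1 (1 + 4 * d)"
    using shift_pinch[OF z0, of 0 1] by (simp add: shift_def flow_0 add.commute)
  then have "bounded_spread (d / 2) z0 (z0 + \<i>)"
    using chain[where i="N - 1"] N0 d(2) by simp
  then show False using not_bounded_spread_vertical d(1) by simp
qed

text \<open>A boundary point of the component \<open>lower b\<close> lies in
  \<open>closure (upper b)\<close>; if it were also in \<open>closure (lower a)\<close>, it would be
  a pinch.\<close>

lemma closure_lower_subset:
  assumes "a < b"
  shows "closure (lower a) \<subseteq> lower b"
proof
  fix z assume z: "z \<in> closure (lower a)"
  show "z \<in> lower b"
  proof (rule ccontr)
    assume "z \<notin> lower b"
    moreover have "z \<in> closure (lower b)" using z closure_mono[OF lower_mono[of a b]] assms by auto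
    ultimately have "z \<in> frontier (lower b)" by (simp add: frontier_def interior_open open_lower)
    then have "z \<in> frontier (- closure (upper b))"
      unfolding lower_def using frontier_of_connected_component_subset by blast
    then have "z \<in> closure (upper b)"
      using frontier_subset_closed[of "closure (upper b)"] by (auto simp: frontier_complement)
    then have "z \<in> pinch a b" using z by (simp add: pinch_def)
    then show False using pinch_empty[OF assms] by simp
  qed
qed

section \<open>The height as a continuous equivariant function\<close>

definition height :: "complex \<Rightarrow> real" where
  "height z = Inf {r. z \<in> lower r}"

lemma levels_nonempty_bdd_below: "{r. z \<in> lower r} \<noteq> {}" "bdd_below {r. z \<in> lower r}"
proof -
  have "z \<in> lower (Im z + C + 1)" by (rule lower_low) simp
  then show "{r. z \<in> lower r} \<noteq> {}" by blast
  show "bdd_below {r. z \<in> lower r}" using lower_not_high by (intro bdd_belowI[of _ "Im z - C"]) force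
qed

lemma height_less_iff: "height z < x \<longleftrightarrow> (\<exists>r<x. z \<in> lower r)"
  unfolding height_def using levels_nonempty_bdd_below[of z] by (subst cInf_less_iff) auto

lemma height_near_Im: "\<bar>height z - Im z\<bar> \<le> C"
proof -
  have "height z \<le> Im z + C + e" if "e > 0" for e
    unfolding height_def using that by (intro cInf_lower levels_nonempty_bdd_below) (auto intro: lower_low)
  then have "height z \<le> Im z + C" by (rule field_le_epsilon)
  moreover have "Im z - C \<le> height z"
    unfolding height_def using lower_not_high by (intro cInf_greatest levels_nonempty_bdd_below) force
  ultimately show ?thesis by linarith
qed

lemma height_equivariant:
  assumes "\<And>r. w \<in> lower (r + s) \<longleftrightarrow> z \<in> lower r"
  shows "height w = height z + s"
proof -
  have "height w < x \<longleftrightarrow> height z + s < x" for x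
  proof -
    have "(\<exists>r<x. w \<in> lower r) \<longleftrightarrow> (\<exists>r<x - s. z \<in> lower r)"
    proof
      assume "\<exists>r<x. w \<in> lower r"
      then obtain r where r: "r < x" "w \<in> lower r" by blast
      then have "z \<in> lower (r - s)" using assms[of "r - s"] by simp
      then show "\<exists>r<x - s. z \<in> lower r" using r(1) by (intro exI[of _ "r - s"]) simp
    next
      assume "\<exists>r<x - s. z \<in> lower r"
      then obtain r where r: "r < x - s" "z \<in> lower r" by blast
      then have "w \<in> lower (r + s)" using assms[of r] by simp
      then show "\<exists>r<x. w \<in> lower r" using r(1) by (intro exI[of _ "r + s"]) simp
    qed
    then show ?thesis
      using height_less_iff[of w x] height_less_iff[of z "x - s"] by (simp only: less_diff_eq)
  qed
  from this[of "height w"] this[of "height z + s"] show ?thesis by simp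
qed

lemma height_flow: "height (\<phi> n z) = height z + n * \<rho>"
  using shift_equivariance(2)[of n 0 z] by (intro height_equivariant) (simp add: shift_def)

lemma height_\<i>: "height (z + of_int m * \<i>) = height z + m"
  using shift_equivariance(2)[of 0 m z] by (intro height_equivariant) (simp add: shift_def flow_0)

lemma height_of_int: "height (z + of_int j) = height z"
proof -
  have "z + of_int j \<in> lower (r + 0) \<longleftrightarrow> z \<in> lower r" for r
    using of_int_equivariance(2)[of z r j] of_int_equivariance(2)[of "z + of_int j" r "- j"] by auto
  then show ?thesis using height_equivariant[of "z + of_int j" 0 z] by simp
qed

text \<open>Openness of the lower sets gives upper semicontinuity. Lower semicontinuity comes from
  the inclusion of closures, that is, from the absence of pinches.\<close>

lemma continuous_height: "continuous_on UNIV height"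
proof -
  have "isCont height z" for z
    unfolding isCont_def
  proof (rule order_tendstoI)
    fix x assume "x < height z"
    then obtain r r' where r: "x < r" "r < r'" "r' < height z" by (meson dense)
    have "z \<notin> lower r'"
    proof
      assume "z \<in> lower r'"
      then have "height z \<le> r'" unfolding height_def by (intro cInf_lower levels_nonempty_bdd_below) simp
      then show False using r(3) by simp
    qed
    then have "z \<in> - closure (lower r)" using closure_lower_subset[OF r(2)] by auto
    then have "\<forall>\<^sub>F w in at z. w \<in> - closure (lower r)"
      by (intro topological_tendstoD[OF tendsto_ident_at]) auto
    then show "\<forall>\<^sub>F w in at z. x < height w"
    proof eventually_elim
      case (elim w)
      have "r \<le> height w"
      proof (rule ccontr)
        assume "\<not> ?thesis"
        then obtain s where "s < r" "w \<in> lower s" using height_less_iff[of w r] by auto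
        then have "w \<in> closure (lower r)" using lower_mono[of s r] closure_subset[of "lower r"] by auto
        then show False using elim by simp
      qed
      then show ?case using r(1) by simp
    qed
  next
    fix x assume "height z < x"
    then obtain r where r: "r < x" "z \<in> lower r" by (auto simp: height_less_iff)
    then have "\<forall>\<^sub>F w in at z. w \<in> lower r"
      by (intro topological_tendstoD[OF tendsto_ident_at] open_lower)
    then show "\<forall>\<^sub>F w in at z. height w < x"
      by (rule eventually_mono) (use r(1) in \<open>auto simp: height_less_iff\<close>)
  qed
  then show ?thesis by (simp add: continuous_at_imp_continuous_on)
qed

end

subsection \<open>Lifts of torus maps\<close>

lemma cis_2pi_eq_iff: "cis (2 * pi * x) = cis (2 * pi * y) \<longleftrightarrow> x - y \<in> \<int>"
proof -
  have "cis (2 * pi * x) = cis (2 * pi * y) \<longleftrightarrow> (\<exists>n::int. 2 * pi * x = 2 * pi * y + 2 * pi * n)"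
    by (auto simp: complex_eq_iff sin_cos_eq_iff[symmetric])
  also have "\<dots> \<longleftrightarrow> (\<exists>n::int. x - y = n)"
    by (simp add: ring_distribs(1)[symmetric] mult.assoc[symmetric]) (auto simp: algebra_simps)
  finally show ?thesis by (auto simp: Ints_def)
qed

lemma Ints_valued_continuous_constant:
  fixes f :: "'a::topological_space \<Rightarrow> real"
  assumes "connected S" "continuous_on S f" "\<And>x. x \<in> S \<Longrightarrow> f x \<in> \<int>" "x \<in> S" "y \<in> S"
  shows "f x = f y"
proof -
  have "f constant_on S"
  proof (rule continuous_discrete_range_constant[OF assms(1,2)])
    fix x assume "x \<in> S"
    then have "1 \<le> norm (f y - f x)" if "y \<in> S" "f y \<noteq> f x" for y
      using that assms(3) Ints_nonzero_abs_ge1[of "f y - f x"] by auto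
    then show "\<exists>e>0. \<forall>y. y \<in> S \<and> f y \<noteq> f x \<longrightarrow> e \<le> norm (f y - f x)"
      by (intro exI[of _ 1]) auto
  qed
  then show ?thesis using assms(4,5) by (auto simp: constant_on_def)
qed

text \<open>The coordinate characters of the torus, which determine a point modulo integer
  vectors.\<close>

lift_definition torus_char :: "2 \<Rightarrow> torus \<Rightarrow> complex" is "\<lambda>i z. cis (2 * pi * z $ i)"
  by (simp add: cis_2pi_eq_iff)

lemma continuous_torus_iff: "continuous_on UNIV g \<longleftrightarrow> continuous_on UNIV (g \<circ> abs_torus)"
  by (simp add: continuous_on_open_vimage open_torus_def vimage_def)

lemma continuous_abs_torus: "continuous_on UNIV abs_torus"
  using continuous_torus_iff[of id] by (simp add: continuous_on_id)

lemma continuous_torus_char: "continuous_on UNIV (torus_char i)"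
  unfolding continuous_torus_iff o_def torus_char.abs_eq
  by (intro continuous_intros)

lemma abs_torus_eq_iff: "abs_torus z = abs_torus w \<longleftrightarrow> (\<forall>i. (z - w) $ i \<in> \<int>)"
  by (simp add: torus.abs_eq_iff)

text \<open>Composing the homotopy with the characters of the torus gives maps into the unit circle, whose
  continuous logarithms on \<open>[0,1] \<times> \<real>\<^sup>2\<close> are the coordinates of a lifted homotopy.\<close>

lemma homotopic_lifts_same_translations:
  assumes hom: "homotopic_with_canon (\<lambda>_. True) UNIV UNIV f g"
    and F: "continuous_on UNIV F" "abs_torus \<circ> F = f \<circ> abs_torus"
    and G: "continuous_on UNIV G" "abs_torus \<circ> G = g \<circ> abs_torus"
    and v: "\<forall>i. v $ i \<in> \<int>"
  shows "F (z + v) - F z = G (z + v) - G z"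
proof -
  obtain h :: "real \<times> torus \<Rightarrow> torus"
    where "continuous_map (prod_topology (top_of_set {0..1}) (top_of_set UNIV)) (top_of_set UNIV) h"
      and h_ends: "\<And>x. h (0, x) = f x" "\<And>x. h (1, x) = g x"
    using hom unfolding homotopic_with_def by auto
  then have h: "continuous_on ({0..1} \<times> UNIV) h"
    unfolding prod_topology_subtopology_eu by simp
  define S :: "(real \<times> (real^2)) set" where "S = {0..1} \<times> UNIV"
  have conv: "convex S" unfolding S_def by (intro convex_Times) auto
  have "F (z + v) $ i - F z $ i = G (z + v) $ i - G z $ i" for i
  proof -
    define K where "K x = torus_char i (h (fst x, abs_torus (snd x)))" for x
    have "continuous_on S K"
      unfolding K_def S_def
      by (intro continuous_on_compose2[OF continuous_torus_char] continuous_on_compose2[OF h]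
          continuous_on_compose2[OF continuous_abs_torus] continuous_intros) auto
    moreover have K1: "norm (K x) = 1" for x unfolding K_def by transfer simp
    ultimately obtain l where l: "continuous_on S l" "\<And>x. x \<in> S \<Longrightarrow> K x = exp (l x)"
      using continuous_logarithm_on_contractible[of S K] convex_imp_contractible[OF conv]
      by (metis norm_zero zero_neq_one)
    define \<theta> where "\<theta> x = Im (l x) / (2 * pi)" for x
    have cont: "continuous_on S \<theta>" unfolding \<theta>_def by (intro continuous_intros l) auto
    have \<theta>: "K x = cis (2 * pi * \<theta> x)" if "x \<in> S" for x
    proof -
      have "Re (l x) = 0" using l(2)[OF that] K1[of x] by simp
      then show ?thesis using l(2)[OF that] by (simp add: \<theta>_def exp_eq_polar)
    qed
    \<comment> \<open>At a fixed time, \<theta> and a coordinate of a lift give the same character,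
      so they differ by a constant integer.\<close>
    have end_lift: "\<theta> (t, w) - H w $ i = \<theta> (t, w') - H w' $ i"
      if t: "t \<in> {0..1}" and H: "continuous_on UNIV H" "\<And>x. abs_torus (H x) = h (t, abs_torus x)" for t H w w'
    proof (rule Ints_valued_continuous_constant[of UNIV "\<lambda>w. \<theta> (t, w) - H w $ i"])
      show "continuous_on UNIV (\<lambda>w. \<theta> (t, w) - H w $ i)"
        using t by (intro continuous_intros continuous_on_compose2[OF cont] H) (auto simp: S_def)
      fix w
      have "cis (2 * pi * \<theta> (t, w)) = cis (2 * pi * H w $ i)"
        using \<theta>[of "(t, w)"] t by (simp add: S_def K_def H(2)[symmetric] torus_char.abs_eq)
      then show "\<theta> (t, w) - H w $ i \<in> \<int>" by (simp add: cis_2pi_eq_iff)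
    qed auto
    have *: "\<theta> (0, z + v) - \<theta> (0, z) = \<theta> (1, z + v) - \<theta> (1, z)"
    proof -
      \<comment> \<open>The change of \<theta> under the deck translation \<open>v\<close> is a
        continuous integer-valued function on the connected \<open>S\<close>, hence the same at both
        ends of the homotopy.\<close>
      let ?\<delta> = "\<lambda>x. \<theta> (fst x, snd x + v) - \<theta> x"
      have "?\<delta> (0, z) = ?\<delta> (1, z)"
      proof (rule Ints_valued_continuous_constant[of S])
        show "connected S" using conv by (rule convex_connected)
        show "continuous_on S ?\<delta>"
          by (intro continuous_intros cont continuous_on_compose2[OF cont]) (auto simp: S_def)
        fix x assume "x \<in> S"
        then have x: "x \<in> S" "(fst x, snd x + v) \<in> S" by (auto simp: S_def)
        have "abs_torus (snd x + v) = abs_torus (snd x)" using v by (simp add: abs_torus_eq_iff)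
        then have "K (fst x, snd x + v) = K x" by (simp add: K_def)
        then show "?\<delta> x \<in> \<int>" using \<theta>[OF x(1)] \<theta>[OF x(2)] by (simp add: cis_2pi_eq_iff)
      qed (auto simp: S_def)
      then show ?thesis by simp
    qed
    have "\<And>x. abs_torus (F x) = h (0, abs_torus x)" "\<And>x. abs_torus (G x) = h (1, abs_torus x)"
      using fun_cong[OF F(2)] fun_cong[OF G(2)] h_ends by simp_all
    then show ?thesis
      using end_lift[of 0 F "z + v" z] end_lift[of 1 G "z + v" z] F(1) G(1) * by simp
  qed
  then show ?thesis by (simp add: vec_eq_iff)
qed

section \<open>Integer iterates and complex coordinates\<close>

lemma int_iterate_bij:
  assumes "bij F"
  shows "int_iterate F 0 z = z" and "int_iterate F (n + 1) z = F (int_iterate F n z)"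
    and "int_iterate F (m + n) z = int_iterate F m (int_iterate F n z)"
proof -
  show "int_iterate F 0 z = z" for z by (simp add: int_iterate_def)
  have step: "int_iterate F (n + 1) z = F (int_iterate F n z)" for n z
  proof (cases "n \<ge> 0")
    case True
    then show ?thesis by (simp add: int_iterate_def nat_add_distrib)
  next
    case False
    \<comment> \<open>Here \<open>n + 1 = - j\<close>; the case \<open>j = 0\<close> is separate
      because \<open>int_iterate\<close> then switches to its nonnegative branch.\<close>
    then obtain j where j: "n = - int (Suc j)" by (metis not_le zero_le_imp_eq_int neg_int_cases Suc_pred)
    have "F (inv F x) = x" for x using assms by (simp add: bij_is_surj surj_f_inv_f)
    then show ?thesis by (cases "j = 0") (auto simp: j int_iterate_def nat_add_distrib)
  qed
  then show "int_iterate F (n + 1) z = F (int_iterate F n z)" for n z .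
  show "int_iterate F (m + n) z = int_iterate F m (int_iterate F n z)"
  proof (induction m rule: int_induct[where k=0])
    case base
    then show ?case by (simp add: int_iterate_def)
  next
    case (step1 i)
    have "int_iterate F (i + 1 + n) z = F (int_iterate F (i + n) z)"
      using step[of "i + n" z] by (simp add: ac_simps)
    then show ?case using step1 step by simp
  next
    case (step2 i)
    have "F (int_iterate F (i - 1 + n) z) = F (int_iterate F (i - 1) (int_iterate F n z))"
      using step[of "i - 1 + n" z] step[of "i - 1"] step2 by (simp add: ac_simps)
    then show ?case using assms by (simp add: bij_is_inj inj_eq)
  qed
qed

definition to_complex :: "real^2 \<Rightarrow> complex" where
  "to_complex z = Complex (z $ 1) (z $ 2)"

definition of_complex :: "complex \<Rightarrow> real^2" where
  "of_complex w = vector [Re w, Im w]"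

lemma to_of_complex [simp]: "to_complex (of_complex w) = w" "of_complex (to_complex z) = z"
  by (simp_all add: to_complex_def of_complex_def vec_eq_iff forall_2)

lemma of_complex_nth [simp]: "of_complex w $ 1 = Re w" "of_complex w $ 2 = Im w"
  by (simp_all add: of_complex_def)

lemma to_complex_add: "to_complex (z + w) = to_complex z + to_complex w"
  by (simp add: to_complex_def complex_eq_iff)

lemma of_complex_add: "of_complex (z + w) = of_complex z + of_complex w"
  by (simp add: vec_eq_iff forall_2)

lemma continuous_to_complex: "continuous_on S to_complex"
  unfolding to_complex_def Complex_eq by (intro continuous_intros)

lemma continuous_of_complex: "continuous_on S of_complex"
proof -
  have eq: "of_complex = (\<lambda>w. \<chi> i. if i = 1 then Re w else Im w)"
    by (auto simp: fun_eq_iff vec_eq_iff forall_2)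
  have "continuous_on S (\<lambda>w. if i = 1 then Re w else Im w)" for i :: 2
    by (cases "i = 1") (auto intro: continuous_intros)
  then show ?thesis unfolding eq by (rule continuous_on_vec_lambda)
qed

lemma dehn_matrix_mult [simp]: "(dehn_matrix k *v v) $ 1 = v $ 1 + of_int k * v $ 2" "(dehn_matrix k *v v) $ 2 = v $ 2"
  by (simp_all add: dehn_matrix_def matrix_vector_mult_def sum_2)

text \<open>The matrix itself lifts the Dehn twist, so by homotopy \<open>F\<close> responds to deck
  translations exactly as the matrix does. The other locale conditions are properties of iterates or
  hypotheses.\<close>

lemma dehn_flow_of_lift:
  assumes hom: "homotopic_with_canon (\<lambda>_. True) UNIV UNIV f (dehn_twist k)" and k: "k \<noteq> 0"
    and lift: "is_lift F f" and irr: "\<rho> \<notin> \<rat>"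
    and dev: "\<forall>z n. \<bar>(int_iterate F n z - z) $ 2 - of_int n * \<rho>\<bar> \<le> C"
  shows "dehn_flow (\<lambda>n w. to_complex (int_iterate F n (of_complex w))) (of_int k) \<rho> C"
proof -
  obtain G where FG: "homeomorphism UNIV UNIV F G" and F: "abs_torus \<circ> F = f \<circ> abs_torus"
    using lift by (auto simp: is_lift_def homeo_def)
  have GF: "G (F z) = z" "F (G z) = z" for z using FG by (auto simp: homeomorphism_def)
  then have bij: "bij F" by (metis bijI')
  have inv: "inv F = G" using GF by (metis inv_equality)
  have contF: "continuous_on UNIV F" "continuous_on UNIV G" using FG by (auto simp: homeomorphism_def)
  note it = int_iterate_bij[OF bij]
  have pow: "continuous_on UNIV (g ^^ j)" if "continuous_on UNIV g" for g :: "real^2 \<Rightarrow> real^2" and j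
    by (induction j) (auto intro: continuous_on_compose2[OF that] simp: continuous_on_id)
  have cont: "continuous_on UNIV (int_iterate F n)" for n
    unfolding int_iterate_def inv using pow contF by simp
  have trans: "F (z + v) = F z + dehn_matrix k *v v" if "\<forall>i. v $ i \<in> \<int>" for z v
  proof -
    have "F (z + v) - F z = dehn_matrix k *v (z + v) - dehn_matrix k *v z"
    proof (rule homotopic_lifts_same_translations[OF hom contF(1) F _ _ that])
      show "continuous_on UNIV ((*v) (dehn_matrix k))" by (intro matrix_vector_mult_linear_continuous_on)
      show "abs_torus \<circ> (*v) (dehn_matrix k) = dehn_twist k \<circ> abs_torus"
        by (simp add: fun_eq_iff dehn_twist.abs_eq)
    qed
    then show ?thesis by (simp add: matrix_vector_right_distrib algebra_simps)
  qed
  \<comment> \<open>The n-th power of the twist matrix has entry \<open>n * k\<close>. Downward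
    induction applies \<open>F\<close> to both sides and cancels it by injectivity.\<close>
  have iter: "int_iterate F n (z + of_complex (of_int a + of_int b * \<i>))
      = int_iterate F n z + of_complex (of_int (a + n * k * b) + of_int b * \<i>)" for n z a b
  proof (induction n rule: int_induct[where k=0])
    case base
    then show ?case by (simp add: it)
  next
    case (step1 i)
    show ?case
      unfolding it(2) step1 by (subst trans) (auto simp: forall_2 vec_eq_iff algebra_simps)
  next
    case (step2 i)
    have "F (int_iterate F (i - 1) (z + of_complex (of_int a + of_int b * \<i>)))
       = int_iterate F i (z + of_complex (of_int a + of_int b * \<i>))"
      using it(2)[of "i - 1"] by simp
    also have "\<dots> = F (int_iterate F (i - 1) z) + of_complex (of_int (a + i * k * b) + of_int b * \<i>)"
      unfolding step2 using it(2)[of "i - 1" z] by simp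
    also have "\<dots> = F (int_iterate F (i - 1) z + of_complex (of_int (a + (i - 1) * k * b) + of_int b * \<i>))"
      by (subst trans) (auto simp: forall_2 vec_eq_iff algebra_simps)
    finally show ?case using bij by (simp add: bij_is_inj inj_eq)
  qed
  show ?thesis
  proof
    fix n m :: int and z :: complex
    let ?\<phi> = "\<lambda>n w. to_complex (int_iterate F n (of_complex w))"
    show "?\<phi> 0 z = z" by (simp add: it)
    show "?\<phi> (m + n) z = ?\<phi> m (?\<phi> n z)" by (simp add: it(3))
    show "continuous_on UNIV (?\<phi> n)"
      by (intro continuous_on_compose2[OF continuous_to_complex] continuous_on_compose2[OF cont] continuous_of_complex) auto
    show "?\<phi> n (z + 1) = ?\<phi> n z + 1"
      using iter[of n "of_complex z" 1 0] by (simp add: of_complex_add to_complex_add)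
    show "?\<phi> n (z + \<i>) = ?\<phi> n z + of_real (real_of_int n * real_of_int k) + \<i>"
      using iter[of n "of_complex z" 0 1] by (simp add: of_complex_add to_complex_add add.assoc)
    show "of_int k \<noteq> (0 :: real)" "\<rho> \<notin> \<rat>" using k irr by auto
    show "\<bar>Im (?\<phi> n z) - Im z - n * \<rho>\<bar> \<le> C"
      using spec[OF spec[OF dev, of "of_complex z"], of n] by (simp add: to_complex_def)
  qed
qed

section \<open>Descent of the height to a circle factor of the torus map\<close>

theorem theorem1:
  fixes f :: "torus \<Rightarrow> torus" and F :: "real^2 \<Rightarrow> real^2" and \<rho> C :: real
  assumes "homeo f"
    and "\<exists>k :: int. k \<noteq> 0 \<and> homotopic_with_canon (\<lambda>_. True) UNIV UNIV f (dehn_twist k)"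
    and "is_lift F f"
    and "\<rho> \<notin> \<rat>"
    and "C > 0"
    and "\<forall>(z :: real^2) (n :: int). \<bar>(int_iterate F n z - z) $ 2 - of_int n * \<rho>\<bar> \<le> C"
  shows "admits_irrational_circle_factor f \<rho>"
proof -
  obtain k where k: "k \<noteq> 0" "homotopic_with_canon (\<lambda>_. True) UNIV UNIV f (dehn_twist k)"
    using assms(2) by blast
  interpret dehn_flow "\<lambda>n w. to_complex (int_iterate F n (of_complex w))" "of_int k" \<rho> C
    using dehn_flow_of_lift[OF k(2,1) assms(3,4,6)] .
  define H where "H z = height (to_complex z)" for z
  have H_F: "H (F z) = H z + \<rho>" for z
    using height_flow[of 1 "to_complex z"] by (simp add: H_def int_iterate_def)
  have H_int: "H z - H w \<in> \<int>" if zw: "\<forall>i. (z - w) $ i \<in> \<int>" for z w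
  proof -
    obtain a b :: int where ab: "z $ 1 - w $ 1 = a" "z $ 2 - w $ 2 = b"
      using zw by (auto simp: forall_2 Ints_def)
    have "to_complex z = (to_complex w + of_int a) + of_int b * \<i>"
      using ab by (simp add: to_complex_def complex_eq_iff)
    then show ?thesis by (simp add: H_def height_\<i> height_of_int)
  qed
  have cont_H: "continuous_on UNIV H"
    unfolding H_def by (intro continuous_on_compose2[OF continuous_height continuous_to_complex]) auto
  \<comment> \<open>The choice of representative is immaterial, because integer translations change
    \<open>H\<close> by integers.\<close>
  define h where "h x = abs_circle (H (rep_torus x))" for x
  have h_abs: "h (abs_torus z) = abs_circle (H z)" for z
  proof -
    have "abs_torus (rep_torus (abs_torus z)) = abs_torus z"
      by (simp add: Quotient3_abs_rep[OF Quotient3_torus])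
    then show ?thesis unfolding h_def circle.abs_eq_iff using H_int abs_torus_eq_iff by blast
  qed
  have "continuous_on UNIV (abs_circle \<circ> H)"
  proof -
    have "open (H -` (abs_circle -` B))" if "open B" for B
      using that cont_H by (simp add: open_circle_def continuous_on_open_vimage)
    then show ?thesis by (simp add: continuous_on_open_vimage vimage_def)
  qed
  then have "continuous_on UNIV h" unfolding continuous_torus_iff by (simp add: o_def h_abs)
  moreover have "surj h"
  proof -
    \<comment> \<open>Since the height differs from the imaginary part by at most \<open>C\<close>,
      \<open>H\<close> takes values on both sides of \<open>y\<close>, and its range is
      connected.\<close>
    have "y \<in> range H" for y
    proof (rule connectedD_interval[of "range H"])
      show "connected (range H)" using cont_H by (intro connected_continuous_image) auto
      show "H (of_complex (Complex 0 (y - C))) \<in> range H" "H (of_complex (Complex 0 (y + C))) \<in> range H"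
        by blast+
      show "H (of_complex (Complex 0 (y - C))) \<le> y" "y \<le> H (of_complex (Complex 0 (y + C)))"
        using height_near_Im[of "Complex 0 (y - C)"] height_near_Im[of "Complex 0 (y + C)"]
        by (auto simp: H_def)
    qed
    then have "\<exists>z. abs_circle y = h (abs_torus z)" for y by (metis h_abs rangeE)
    then show ?thesis
      unfolding surj_def by (metis Quotient3_abs_rep[OF Quotient3_circle])
  qed
  moreover have "h \<circ> f = rotation \<rho> \<circ> h"
  proof
    fix x
    obtain z where z: "x = abs_torus z" by (metis Quotient3_abs_rep[OF Quotient3_torus])
    have "f x = abs_torus (F z)" using assms(3) z by (auto simp: is_lift_def fun_eq_iff)
    then show "(h \<circ> f) x = (rotation \<rho> \<circ> h) x" by (simp add: z h_abs H_F rotation.abs_eq)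
  qed
  ultimately show ?thesis unfolding admits_irrational_circle_factor_def using assms(4) by blast
qed

end
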